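(* Let $g\in L^2(\mathbb R)$ be supported on a ray $[\alpha,\infty)$ for some $\alpha\in\mathbb R$ (in particular, this applies up to this hypothesis if $g$ has compact support). The following are equivalent: (1) $(E_mT_ng)_{m,n\in\mathbb Z}$ is complete in $L^2(\mathbb R)$. (2) $\sup_{n\in\mathbb Z}|g(x-n)|\ne0$ for a.e. $x$.
   Context: $T_cf(x)=f(x-c)$, $E_cf(x)=e^{2\pi icx}f(x)$. A family is complete in $L^2(\mathbb R)$ if its closed linear span is $L^2(\mathbb R)$ (complex-valued functions). *)

theory Defs
  imports "HOL-Analysis.Analysis"
begin

text \<open>Elements of \<open>L\<^sup>2(\<real>)\<close> are represented by complex-valued functions rather than by classes
  modulo null sets. Whether a family is complete does not depend on the representatives.\<close>

definition L2 :: "(real \<Rightarrow> complex) set" where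
  "L2 = {f. f \<in> borel_measurable lebesgue \<and> integrable lebesgue (\<lambda>x. (cmod (f x))\<^sup>2)}"

definition L2_norm :: "(real \<Rightarrow> complex) \<Rightarrow> real" where
  "L2_norm f = sqrt (LINT x|lebesgue. (cmod (f x))\<^sup>2)"

definition linear_span :: "(real \<Rightarrow> complex) set \<Rightarrow> (real \<Rightarrow> complex) set" where
  "linear_span S = {\<lambda>x. \<Sum>s\<in>F. c s * s x | F c. finite F \<and> F \<subseteq> S}"

text \<open>For \<open>S \<subseteq> L2\<close>, the closure of \<open>S\<close> in the seminorm \<^const>\<open>L2_norm\<close>. For \<open>S\<close> not contained in
  \<^const>\<open>L2\<close> this need not be meaningful, as the Bochner integral of a non-integrable function is 0.\<close>

definition L2_closure :: "(real \<Rightarrow> complex) set \<Rightarrow> (real \<Rightarrow> complex) set" where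
  "L2_closure S = {f \<in> L2. \<forall>\<epsilon>>0. \<exists>h\<in>S. L2_norm (\<lambda>x. f x - h x) < \<epsilon>}"

definition complete_in_L2 :: "('i \<Rightarrow> real \<Rightarrow> complex) \<Rightarrow> bool" where
  "complete_in_L2 \<phi> \<longleftrightarrow> range \<phi> \<subseteq> L2 \<and> L2_closure (linear_span (range \<phi>)) = L2"

definition translation :: "real \<Rightarrow> (real \<Rightarrow> complex) \<Rightarrow> real \<Rightarrow> complex" where
  "translation c f = (\<lambda>x. f (x - c))"

definition modulation :: "real \<Rightarrow> (real \<Rightarrow> complex) \<Rightarrow> real \<Rightarrow> complex" where
  "modulation c f = (\<lambda>x. exp (2 * of_real pi * \<i> * of_real c * of_real x) * f x)"

end

theory Submission
  imports Defs
begin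

text \<open>All elements of the span vanish on \<open>{x. \<forall>n. g (x - n) = 0}\<close>, which gives one implication. For
  the other, the closed span \<open>V\<close> of the system is invariant under
  multiplication by indicators of periodic measurable sets, so everything reduces to the fibres
  \<open>k \<mapsto> g (x + k)\<close>, \<open>x \<in> [0, 1)\<close>. Almost every fibre is a nonzero element of \<open>\<ell>\<^sup>2(\<int>)\<close> that vanishes
  near \<open>-\<infinity>\<close>, and such a sequence \<open>G\<close> is cyclic for the bilateral shift: the part \<open>q\<close> of \<open>G\<close>
  orthogonal to the closed span of the forward translates of \<open>G\<close> is nonzero, its translates are
  orthogonal to each other, and by Parseval they span \<open>\<ell>\<^sup>2(\<int>)\<close>. A measurable choice of approximate
  coefficients from a countable dense set of finite sequences transfers this to \<open>V\<close>.\<close>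

subsection \<open>The Hilbert space of square summable bilateral sequences\<close>

text \<open>A general nonzero element of ell2(Z) need not be cyclic for the bilateral shift: its
  Fourier series may vanish on a set of positive measure. The ray excludes this, since almost every
  fibre then has a first nonzero entry and its Fourier series is, up to a shift, in the Hardy space
  H^2. Nonvanishing of such a series almost everywhere is a classical theorem on boundary values;
  the argument through \<open>q\<close>, the start of a Wold decomposition, avoids boundary values
  altogether. In Fourier terms, orthogonality of the translates of \<open>q\<close> says that the
  series of \<open>q\<close> has constant modulus on the circle.

  The second obstacle is that good coefficients on one fibre are bad on another, while finite
  combinations of the system only offer trigonometric polynomials as coefficients. Invariance under
  periodic indicators allows countably many constant coefficient lists to be glued along a periodic
  partition. Approximating the single delta sequence suffices, because translations move it to every
  other position.\<close>

lemma summable_on_inner: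
  fixes f g :: "'i \<Rightarrow> 'a :: real_inner"
  assumes "(\<lambda>k. (norm (f k))\<^sup>2) summable_on A" "(\<lambda>k. (norm (g k))\<^sup>2) summable_on A"
  shows "(\<lambda>k. inner (f k) (g k)) summable_on A"
proof (rule abs_summable_summable, rule summable_on_comparison_test)
  show "(\<lambda>k. (norm (f k))\<^sup>2 + (norm (g k))\<^sup>2) summable_on A"
    using assms by (rule summable_on_add)
  show "norm (inner (f k) (g k)) \<le> (norm (f k))\<^sup>2 + (norm (g k))\<^sup>2" for k
  proof -
    have "\<bar>inner (f k) (g k)\<bar> \<le> norm (f k) * norm (g k)"
      by (rule Cauchy_Schwarz_ineq2)
    moreover have "2 * (norm (f k) * norm (g k)) \<le> (norm (f k))\<^sup>2 + (norm (g k))\<^sup>2"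
      using sum_squares_bound[of "norm (f k)" "norm (g k)"] by simp
    moreover have "0 \<le> norm (f k) * norm (g k)" by simp
    ultimately show ?thesis by simp
  qed
qed auto

lemma norm_add_squared_le:
  fixes a b :: "'a :: real_normed_vector"
  shows "(norm (a + b))\<^sup>2 \<le> 2 * (norm a)\<^sup>2 + 2 * (norm b)\<^sup>2"
proof -
  have "(norm (a + b))\<^sup>2 \<le> (norm a + norm b)\<^sup>2"
    by (intro power_mono norm_triangle_ineq) auto
  also have "\<dots> \<le> 2 * (norm a)\<^sup>2 + 2 * (norm b)\<^sup>2"
    using sum_squares_bound[of "norm a" "norm b"] by (simp add: power2_sum)
  finally show ?thesis .
qed

lemma summable_on_norm_add_squared:
  fixes f g :: "'i \<Rightarrow> 'a :: real_normed_vector"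
  assumes "(\<lambda>k. (norm (f k))\<^sup>2) summable_on A" "(\<lambda>k. (norm (g k))\<^sup>2) summable_on A"
  shows "(\<lambda>k. (norm (f k + g k))\<^sup>2) summable_on A"
proof (rule summable_on_comparison_test)
  show "(\<lambda>k. 2 * (norm (f k))\<^sup>2 + 2 * (norm (g k))\<^sup>2) summable_on A"
    by (intro summable_on_add summable_on_cmult_right assms)
qed (auto intro: norm_add_squared_le)

text \<open>A type of its own makes \<open>closure\<close>, \<open>span\<close> and the classes
  \<open>real_inner\<close> and \<open>complete_space\<close> available. The structure is real:
  \<open>inner\<close> is the real part of the Hermitian product, and complex scalars are carried by
  \<open>ell2_shift\<close>.\<close>

typedef ell2 = "{f :: int \<Rightarrow> complex. (\<lambda>k. (cmod (f k))\<^sup>2) summable_on UNIV}"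
  morphisms ell2_nth Abs_ell2
  by (rule exI[of _ "\<lambda>_. 0"]) simp

setup_lifting type_definition_ell2

lemma ell2_eqI: "(\<And>k. ell2_nth f k = ell2_nth g k) \<Longrightarrow> f = g"
  by transfer auto

lemma ell2_nth_summable: "(\<lambda>k. (cmod (ell2_nth f k))\<^sup>2) summable_on UNIV"
  by transfer

instantiation ell2 :: real_vector
begin

lift_definition zero_ell2 :: ell2 is "\<lambda>_. 0" by simp
lift_definition plus_ell2 :: "ell2 \<Rightarrow> ell2 \<Rightarrow> ell2" is "\<lambda>f g k. f k + g k"
  by (rule summable_on_norm_add_squared)
lift_definition uminus_ell2 :: "ell2 \<Rightarrow> ell2" is "\<lambda>f k. - f k" by simp
lift_definition minus_ell2 :: "ell2 \<Rightarrow> ell2 \<Rightarrow> ell2" is "\<lambda>f g k. f k - g k"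
  subgoal for f g using summable_on_norm_add_squared[of f UNIV "\<lambda>k. - g k"] by simp
  done
lift_definition scaleR_ell2 :: "real \<Rightarrow> ell2 \<Rightarrow> ell2" is "\<lambda>r f k. r *\<^sub>R f k"
  by (auto simp: power_mult_distrib intro: summable_on_cmult_right)

lemmas ell2_nth_simps = zero_ell2.rep_eq plus_ell2.rep_eq uminus_ell2.rep_eq minus_ell2.rep_eq
  scaleR_ell2.rep_eq

instance
  by standard (auto intro!: ell2_eqI simp: ell2_nth_simps algebra_simps)

end

lemma ell2_inner_summable: "(\<lambda>k. inner (ell2_nth f k) (ell2_nth g k)) summable_on UNIV"
  by (intro summable_on_inner ell2_nth_summable)

instantiation ell2 :: real_inner
begin

definition inner_ell2 :: "ell2 \<Rightarrow> ell2 \<Rightarrow> real" where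
  "inner_ell2 f g = (\<Sum>\<^sub>\<infinity>k. inner (ell2_nth f k) (ell2_nth g k))"
definition norm_ell2 :: "ell2 \<Rightarrow> real" where
  "norm_ell2 f = sqrt (inner f f)"
definition sgn_ell2 :: "ell2 \<Rightarrow> ell2" where
  "sgn_ell2 f = f /\<^sub>R norm f"
definition dist_ell2 :: "ell2 \<Rightarrow> ell2 \<Rightarrow> real" where
  "dist_ell2 f g = norm (f - g)"
definition uniformity_ell2 :: "(ell2 \<times> ell2) filter" where
  "uniformity_ell2 = (INF e\<in>{0 <..}. principal {(x, y). dist x y < e})"
definition open_ell2 :: "ell2 set \<Rightarrow> bool" where
  "open_ell2 U \<longleftrightarrow> (\<forall>x\<in>U. \<forall>\<^sub>F (x', y) in uniformity. x' = x \<longrightarrow> y \<in> U)"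

instance
proof
  fix f g h :: ell2 and r s :: real
  show "dist f g = norm (f - g)" "sgn f = f /\<^sub>R norm f" "norm f = sqrt (inner f f)"
    "uniformity = (INF e\<in>{0 <..}. principal {(x :: ell2, y). dist x y < e})"
    by (simp_all add: dist_ell2_def sgn_ell2_def norm_ell2_def uniformity_ell2_def)
  show "open U \<longleftrightarrow> (\<forall>x\<in>U. \<forall>\<^sub>F (x', y) in uniformity. x' = x \<longrightarrow> y \<in> U)" for U :: "ell2 set"
    by (simp add: open_ell2_def)
  show "inner f g = inner g f"
    by (simp add: inner_ell2_def inner_commute)
  show "inner (f + g) h = inner f h + inner g h"
    by (simp add: inner_ell2_def ell2_nth_simps inner_add_left infsum_add ell2_inner_summable)
  show "inner (r *\<^sub>R f) g = r * inner f g"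
    by (simp add: inner_ell2_def ell2_nth_simps infsum_cmult_right' del: scaleR_conv_of_real)
  show "0 \<le> inner f f"
    by (auto simp: inner_ell2_def intro: infsum_nonneg)
  show "inner f f = 0 \<longleftrightarrow> f = 0"
  proof
    assume "inner f f = 0"
    hence "inner (ell2_nth f k) (ell2_nth f k) = 0" for k
      using nonneg_infsum_le_0D[of "\<lambda>k. inner (ell2_nth f k) (ell2_nth f k)" UNIV k]
        ell2_inner_summable[of f f] by (auto simp: inner_ell2_def)
    thus "f = 0" by (auto intro!: ell2_eqI simp: ell2_nth_simps)
  qed (simp add: inner_ell2_def ell2_nth_simps)
qed

end

lemma norm_ell2_squared: "(norm f)\<^sup>2 = (\<Sum>\<^sub>\<infinity>k. (cmod (ell2_nth f k))\<^sup>2)"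
  by (simp add: power2_norm_eq_inner inner_ell2_def)

lemma sum_le_norm_ell2_squared:
  "finite F \<Longrightarrow> (\<Sum>k\<in>F. (cmod (ell2_nth f k))\<^sup>2) \<le> (norm f)\<^sup>2"
  unfolding norm_ell2_squared by (intro finite_sum_le_infsum ell2_nth_summable) auto

lemma norm_ell2_nth_le: "cmod (ell2_nth f k) \<le> norm f"
  using sum_le_norm_ell2_squared[of "{k}" f] by (auto intro!: power2_le_imp_le[of _ "norm f"])

lemma bounded_linear_ell2_nth: "bounded_linear (\<lambda>f. ell2_nth f k)"
  by (rule bounded_linear_intro[where K = 1]) (auto simp: ell2_nth_simps norm_ell2_nth_le)

instance ell2 :: complete_space
proof
  fix X :: "nat \<Rightarrow> ell2"
  assume X: "Cauchy X"
  have "convergent (\<lambda>n. ell2_nth (X n) k)" for k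
    using X by (intro Cauchy_convergent bounded_linear.Cauchy[OF bounded_linear_ell2_nth])
  then obtain L where L: "\<And>k. (\<lambda>n. ell2_nth (X n) k) \<longlonglongrightarrow> L k"
    unfolding convergent_def by metis
  \<comment> \<open>Coordinatewise convergence passes to the limit only in finite sums, so the bound
    is proved for every finite \<open>F\<close>; the infinite sum follows because the bound is
    uniform in \<open>F\<close>.\<close>
  have fin: "(\<Sum>k\<in>F. (cmod (ell2_nth (X n) k - L k))\<^sup>2) \<le> e\<^sup>2"
    if N: "\<And>m. m \<ge> n \<Longrightarrow> norm (X n - X m) \<le> e" and F: "finite F" for n e F
  proof (rule tendsto_upperbound)
    show "(\<lambda>m. \<Sum>k\<in>F. (cmod (ell2_nth (X n) k - ell2_nth (X m) k))\<^sup>2)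
        \<longlonglongrightarrow> (\<Sum>k\<in>F. (cmod (ell2_nth (X n) k - L k))\<^sup>2)"
      by (intro tendsto_intros L)
    show "\<forall>\<^sub>F m in sequentially. (\<Sum>k\<in>F. (cmod (ell2_nth (X n) k - ell2_nth (X m) k))\<^sup>2) \<le> e\<^sup>2"
      using eventually_ge_at_top[of n]
    proof eventually_elim
      case (elim m)
      have "(\<Sum>k\<in>F. (cmod (ell2_nth (X n - X m) k))\<^sup>2) \<le> (norm (X n - X m))\<^sup>2"
        by (rule sum_le_norm_ell2_squared[OF F])
      also have "\<dots> \<le> e\<^sup>2" using N[OF elim] by (intro power_mono) auto
      finally show ?case by (simp add: ell2_nth_simps)
    qed
  qed simp
  have summ: "(\<lambda>k. (cmod (ell2_nth (X n) k - L k))\<^sup>2) summable_on UNIV"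
    if "\<And>m. m \<ge> n \<Longrightarrow> norm (X n - X m) \<le> e" for n e
  proof (rule nonneg_bdd_above_summable_on)
    show "bdd_above (sum (\<lambda>k. (cmod (ell2_nth (X n) k - L k))\<^sup>2) ` {F. F \<subseteq> UNIV \<and> finite F})"
      by (rule bdd_aboveI2[where M = "e\<^sup>2"]) (use fin[OF that] in blast)
  qed simp
  have Cau: "\<exists>N. \<forall>n\<ge>N. \<forall>m\<ge>n. norm (X n - X m) \<le> e" if e: "e > 0" for e
  proof -
    obtain N where "\<And>m n. m \<ge> N \<Longrightarrow> n \<ge> N \<Longrightarrow> norm (X m - X n) < e"
      using CauchyD[OF X e] by blast
    thus ?thesis by (intro exI[of _ N]) (auto intro: less_imp_le)
  qed
  obtain N1 where N1: "\<And>m. m \<ge> N1 \<Longrightarrow> norm (X N1 - X m) \<le> 1"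
    using Cau[of 1] by auto
  \<comment> \<open>\<open>L\<close> is \<open>X N1\<close> minus the square summable difference of
    \<open>X N1\<close> and \<open>L\<close>.\<close>
  have "(\<lambda>k. (cmod (ell2_nth (X N1) k + - (ell2_nth (X N1) k - L k)))\<^sup>2) summable_on UNIV"
    by (intro summable_on_norm_add_squared ell2_nth_summable)
      (use summ[OF N1] in \<open>simp only: norm_minus_cancel\<close>)
  hence "(\<lambda>k. (cmod (L k))\<^sup>2) summable_on UNIV" by simp
  then obtain l where l: "ell2_nth l = L"
    using Abs_ell2_inverse by auto
  have "X \<longlonglongrightarrow> l"
  proof (rule metric_LIMSEQ_I)
    fix e :: real assume "e > 0"
    then obtain N where N: "\<And>n m. n \<ge> N \<Longrightarrow> m \<ge> n \<Longrightarrow> norm (X n - X m) \<le> e / 2"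
      using Cau[of "e / 2"] by auto
    have "dist (X n) l < e" if "n \<ge> N" for n
    proof -
      have "(norm (X n - l))\<^sup>2 \<le> (e / 2)\<^sup>2"
        unfolding norm_ell2_squared
        using fin[OF N, of n] summ[OF N, of n] that
        by (intro infsum_le_finite_sums) (auto simp: ell2_nth_simps l)
      hence "norm (X n - l) \<le> e / 2"
        using \<open>e > 0\<close> by (auto intro: power2_le_imp_le[of _ "e / 2"])
      thus ?thesis using \<open>e > 0\<close> by (simp add: dist_norm)
    qed
    thus "\<exists>N. \<forall>n\<ge>N. dist (X n) l < e" by blast
  qed
  thus "convergent X" by (auto simp: convergent_def)
qed

subsection \<open>Orthogonal projection\<close>

text \<open>A minimising sequence for the distance converges by the parallelogram law; varying its
  limit along lines in \<open>W\<close> gives orthogonality.\<close>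

lemma orthogonal_projection_exists:
  fixes W :: "'a :: {real_inner, complete_space} set"
  assumes W: "closed W" "subspace W"
  obtains p where "p \<in> W" "\<And>w. w \<in> W \<Longrightarrow> inner (x - p) w = 0"
proof -
  define d where "d = infdist x W"
  have ne: "W \<noteq> {}" using subspace_0[OF W(2)] by auto
  have d: "d \<le> norm (x - w)" if "w \<in> W" for w
    using infdist_le[OF that, of x] by (simp add: d_def dist_norm)
  have "\<exists>w\<in>W. norm (x - w) < d + 1 / Suc n" for n
    using cInf_lessD[of "(\<lambda>w. dist x w) ` W" "d + 1 / Suc n"] ne
    by (auto simp: d_def dist_norm infdist_notempty)
  then obtain X where X: "\<And>n. X n \<in> W" "\<And>n. norm (x - X n) < d + 1 / Suc n"
    by metis
  have d0: "d \<ge> 0" by (simp add: d_def infdist_nonneg)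
  \<comment> \<open>Parallelogram law: the midpoint of \<open>X n\<close> and \<open>X m\<close>
    lies in \<open>W\<close> and so has distance at least \<open>d\<close> from
    \<open>x\<close>.\<close>
  have par: "(norm (X n - X m))\<^sup>2 \<le> 2 * ((d + 1 / Suc n)\<^sup>2 - d\<^sup>2) + 2 * ((d + 1 / Suc m)\<^sup>2 - d\<^sup>2)" for n m
  proof -
    have "(1 / 2) *\<^sub>R (X n + X m) \<in> W"
      by (intro subspace_scale subspace_add W X)
    from d[OF this] have "d\<^sup>2 \<le> (norm (x - (1 / 2) *\<^sub>R (X n + X m)))\<^sup>2"
      using d0 by (intro power_mono)
    also have "\<dots> = (norm (x - X n))\<^sup>2 / 2 + (norm (x - X m))\<^sup>2 / 2 - (norm (X n - X m))\<^sup>2 / 4"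
      unfolding power2_norm_eq_inner by (simp add: inner_simps inner_commute field_simps)
    finally have *: "(norm (X n - X m))\<^sup>2 \<le> 2 * (norm (x - X n))\<^sup>2 + 2 * (norm (x - X m))\<^sup>2 - 4 * d\<^sup>2"
      by simp
    have "(norm (x - X k))\<^sup>2 \<le> (d + 1 / Suc k)\<^sup>2" for k
      using X(2)[of k] by (intro power_mono) auto
    from * this[of n] this[of m] show ?thesis by argo
  qed
  have "Cauchy X"
  proof (rule metric_CauchyI)
    fix e :: real assume e: "e > 0"
    have "(\<lambda>n. 2 * ((d + 1 / real (Suc n))\<^sup>2 - d\<^sup>2)) \<longlonglongrightarrow> 2 * ((d + 0)\<^sup>2 - d\<^sup>2)"
      by (intro tendsto_intros LIMSEQ_Suc[OF lim_1_over_n])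
    hence "\<forall>\<^sub>F n in sequentially. 2 * ((d + 1 / real (Suc n))\<^sup>2 - d\<^sup>2) < e\<^sup>2 / 2"
      using e by (intro order_tendstoD(2)) auto
    then obtain N where N: "\<And>n. n \<ge> N \<Longrightarrow> 2 * ((d + 1 / real (Suc n))\<^sup>2 - d\<^sup>2) < e\<^sup>2 / 2"
      by (auto simp: eventually_sequentially)
    have "dist (X m) (X n) < e" if "m \<ge> N" "n \<ge> N" for m n
    proof -
      have "(norm (X m - X n))\<^sup>2 < e\<^sup>2"
        using par[of m n] N[OF that(1)] N[OF that(2)] by linarith
      thus ?thesis using e by (simp add: dist_norm power_less_imp_less_base)
    qed
    thus "\<exists>M. \<forall>m\<ge>M. \<forall>n\<ge>M. dist (X m) (X n) < e" by blast
  qed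
  then obtain p where p: "X \<longlonglongrightarrow> p"
    using Cauchy_convergent convergent_def by blast
  have pW: "p \<in> W"
    using closed_sequentially[OF W(1) _ p] X by auto
  have "(\<lambda>n. norm (x - X n)) \<longlonglongrightarrow> norm (x - p)"
    by (intro tendsto_intros p)
  moreover have "(\<lambda>n. d + 1 / real (Suc n)) \<longlonglongrightarrow> d + 0"
    by (intro tendsto_intros LIMSEQ_Suc[OF lim_1_over_n])
  ultimately have pd: "norm (x - p) \<le> d"
    using X(2) by (intro LIMSEQ_le[of "\<lambda>n. norm (x - X n)" _ "\<lambda>n. d + 1 / real (Suc n)"])
      (auto intro!: exI[of _ 0] less_imp_le)
  have "inner (x - p) w = 0" if w: "w \<in> W" for w
  proof (rule ccontr)
    assume nz: "inner (x - p) w \<noteq> 0"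
    \<comment> \<open>The parameter at which \<open>p + t *\<^sub>R w\<close> is nearest to
      \<open>x\<close>; that point would beat \<open>p\<close> if the inner product were
      nonzero.\<close>
    define t where "t = inner (x - p) w / inner w w"
    have w0: "inner w w > 0" using nz by (cases "w = 0") auto
    have "p + t *\<^sub>R w \<in> W"
      by (intro subspace_add subspace_scale W pW w)
    hence "(norm (x - p))\<^sup>2 \<le> (norm (x - (p + t *\<^sub>R w)))\<^sup>2"
      using d pd by (intro power_mono) (auto intro: order_trans)
    also have "\<dots> = (norm (x - p))\<^sup>2 - 2 * t * inner (x - p) w + t * t * inner w w"
      unfolding power2_norm_eq_inner by (simp add: inner_simps inner_commute algebra_simps)
    also have "\<dots> = (norm (x - p))\<^sup>2 - (inner (x - p) w)\<^sup>2 / inner w w"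
      using w0 by (simp add: t_def power2_eq_square)
    finally show False using nz w0 by (simp add: divide_le_0_iff)
  qed
  with pW that show ?thesis by blast
qed

subsection \<open>Cyclic vectors of the bilateral shift\<close>

lemma closure_add_mem:
  fixes S :: "'a :: real_normed_vector set"
  assumes "x \<in> closure S" "y \<in> closure S" and add: "\<And>u v. u \<in> S \<Longrightarrow> v \<in> S \<Longrightarrow> u + v \<in> S"
  shows "x + y \<in> closure S"
proof -
  obtain X where X: "\<forall>n. X n \<in> S" "X \<longlonglongrightarrow> x"
    using assms(1) unfolding closure_sequential by blast
  obtain Y where Y: "\<forall>n. Y n \<in> S" "Y \<longlonglongrightarrow> y"
    using assms(2) unfolding closure_sequential by blast
  show ?thesis unfolding closure_sequential
    using X Y by (intro exI[of _ "\<lambda>n. X n + Y n"]) (auto intro: tendsto_add add)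
qed

lemma subspace_closure_real_normed:
  fixes S :: "'a :: real_normed_vector set"
  assumes "subspace S"
  shows "subspace (closure S)"
proof (rule subspaceI)
  show "0 \<in> closure S"
    using subspace_0[OF assms] closure_subset by blast
  show "x + y \<in> closure S" if "x \<in> closure S" "y \<in> closure S" for x y
    using that by (rule closure_add_mem) (rule subspace_add[OF assms])
  show "c *\<^sub>R x \<in> closure S" if x: "x \<in> closure S" for c x
  proof -
    have "c *\<^sub>R x \<in> (*\<^sub>R) c ` closure S" using x by blast
    also have "\<dots> \<subseteq> closure ((*\<^sub>R) c ` S)"
      by (rule closure_bounded_linear_image_subset[OF bounded_linear_scaleR_right])
    also have "\<dots> \<subseteq> closure S"
      by (intro closure_mono) (auto intro: subspace_scale assms)
    finally show ?thesis .
  qed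
qed

lemma bij_diff_int: "bij_betw (\<lambda>k :: int. k - n) UNIV UNIV"
  by (rule bij_betwI[where g = "\<lambda>k. k + n"]) auto

text \<open>Shift and complex factor are fused because \<open>span\<close> and
  \<open>subspace\<close> are real notions: letting \<open>c\<close> range over all complex numbers
  makes the real span of the translates a complex one, and real orthogonality to all of them
  Hermitian orthogonality.\<close>

lift_definition ell2_shift :: "int \<Rightarrow> complex \<Rightarrow> ell2 \<Rightarrow> ell2" is "\<lambda>n c f k. c * f (k - n)"
  subgoal for n c f
    using summable_on_reindex_bij_betw[OF bij_diff_int, of "\<lambda>k. (cmod (f k))\<^sup>2" n]
    by (auto simp: norm_mult power_mult_distrib intro: summable_on_cmult_right)
  done

lift_definition ell2_unit :: ell2 is "\<lambda>k. of_bool (k = 0)"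
  by (rule finite_nonzero_values_imp_summable_on, rule finite_subset[of _ "{0}"]) auto

lemma inner_complex_mult_left: "inner (c * a) b = inner a (cnj c * b)" for a b c :: complex
  by (simp add: inner_complex_def algebra_simps)

text \<open>Adjoint formula. Together with \<open>ell2_shift_shift\<close> it reduces the inner
  product of two translates of a sequence to one translate against the sequence itself, so that only
  the difference of positions matters.\<close>

lemma inner_ell2_shift_left:
  "inner (ell2_shift n c f) g = inner f (ell2_shift (- n) (cnj c) g)"
proof -
  have "inner (ell2_shift n c f) g =
      (\<Sum>\<^sub>\<infinity>k. inner (ell2_nth f (k - n)) (cnj c * ell2_nth g ((k - n) + n)))"
    by (simp add: inner_ell2_def ell2_shift.rep_eq inner_complex_mult_left)
  also have "\<dots> = (\<Sum>\<^sub>\<infinity>k. inner (ell2_nth f k) (cnj c * ell2_nth g (k + n)))"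
    by (rule infsum_reindex_bij_betw[OF bij_diff_int])
  finally show ?thesis
    by (simp add: inner_ell2_def ell2_shift.rep_eq)
qed

lemma ell2_shift_shift: "ell2_shift n c (ell2_shift m d f) = ell2_shift (n + m) (c * d) f"
  by (rule ell2_eqI) (simp add: ell2_shift.rep_eq algebra_simps)

lemma ell2_shift_0_of_real: "ell2_shift 0 (of_real r) f = r *\<^sub>R f"
  by (rule ell2_eqI) (simp add: ell2_shift.rep_eq ell2_nth_simps scaleR_conv_of_real)

lemma norm_ell2_shift: "norm (ell2_shift n c f) = cmod c * norm f"
proof -
  have "inner (ell2_shift n c f) (ell2_shift n c f) = inner f (ell2_shift 0 (of_real ((cmod c)\<^sup>2)) f)"
    by (simp add: inner_ell2_shift_left ell2_shift_shift complex_norm_square mult.commute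
        del: of_real_power)
  also have "\<dots> = (cmod c * norm f)\<^sup>2"
    by (simp add: ell2_shift_0_of_real power2_norm_eq_inner power_mult_distrib
        del: of_real_power)
  finally show ?thesis
    by (simp add: norm_eq_sqrt_inner[of "ell2_shift n c f"])
qed

lemma bounded_linear_ell2_shift: "bounded_linear (ell2_shift n c)"
  by (rule bounded_linear_intro[where K = "cmod c"])
    (auto simp: norm_ell2_shift mult.commute ell2_shift.rep_eq ell2_nth_simps algebra_simps
      intro!: ell2_eqI)

lemma bounded_linear_ell2_shift_coeff: "bounded_linear (\<lambda>c. ell2_shift n c f)"
  by (rule bounded_linear_intro[where K = "norm f"])
    (auto simp: norm_ell2_shift mult.commute ell2_shift.rep_eq ell2_nth_simps algebra_simps
      intro!: ell2_eqI)

lemma inner_ell2_unit: "inner ell2_unit f = Re (ell2_nth f 0)"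
proof -
  have "inner ell2_unit f = (\<Sum>\<^sub>\<infinity>k\<in>{0}. inner (ell2_nth ell2_unit k) (ell2_nth f k))"
    unfolding inner_ell2_def by (rule infsum_cong_neutral) (auto simp: ell2_unit.rep_eq)
  thus ?thesis by (simp add: ell2_unit.rep_eq inner_complex_def)
qed

text \<open>The translates of \<open>q\<close> are orthogonal and all have norm \<open>norm q\<close>. The squared lengths of the
  projections of \<^const>\<open>ell2_unit\<close> to their spans add up to
  \<open>(\<Sum>\<^sub>\<infinity>k. (cmod (ell2_nth q (- k)))\<^sup>2) / (norm q)\<^sup>2 = 1\<close>, so \<^const>\<open>ell2_unit\<close> lies in the closed
  span of these translates.\<close>

lemma ell2_unit_mem_if_shifts_orthogonal:
  assumes V: "closed V" "subspace V" "\<And>n c. ell2_shift n c q \<in> V"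
    and q: "q \<noteq> 0" and orth: "\<And>n c. n \<ge> 1 \<Longrightarrow> inner q (ell2_shift n c q) = 0"
  shows "ell2_unit \<in> V"
proof -
  \<comment> \<open>Moving the shift to the other side and using symmetry turns a backward shift
    into a forward one.\<close>
  have orth': "inner q (ell2_shift n c q) = 0" if "n \<noteq> 0" for n c
  proof (cases "n \<ge> 1")
    case False
    have "inner q (ell2_shift n c q) = inner q (ell2_shift (- n) (cnj c) q)"
      by (subst inner_commute) (simp add: inner_ell2_shift_left)
    also have "\<dots> = 0" using that False by (intro orth) auto
    finally show ?thesis .
  qed (rule orth)
  have norm_q: "norm q > 0" using q by simp
  have "ell2_unit \<in> closure V"
  proof (subst closure_approachable, intro allI impI)
    fix e :: real assume e: "e > 0"
    define d where "d = (norm q)\<^sup>2"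
    have d: "d > 0" using norm_q by (simp add: d_def)
    obtain F where F: "finite F"
        "dist (\<Sum>k\<in>F. (cmod (ell2_nth q k))\<^sup>2) (\<Sum>\<^sub>\<infinity>k. (cmod (ell2_nth q k))\<^sup>2) \<le> d * (e / 2)\<^sup>2"
      using infsum_finite_approximation[OF ell2_nth_summable, of "d * (e / 2)\<^sup>2" q] d e by auto
    define s where "s = (\<Sum>k\<in>F. (cmod (ell2_nth q k))\<^sup>2)"
    have s: "d - s \<le> d * (e / 2)\<^sup>2"
      using F(2) unfolding dist_real_def s_def d_def norm_ell2_squared by linarith
    \<comment> \<open>The translate of \<open>q\<close> by \<open>- k\<close> has entry
      \<open>ell2_nth q k\<close> at 0, so the conjugate of this entry makes
      \<open>(1 / d) *\<^sub>R a k\<close> the Hermitian projection of \<open>ell2_unit\<close> to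
      the complex line through that translate.\<close>
    define a where "a = (\<lambda>k. ell2_shift (- k) (cnj (ell2_nth q k)) q)"
    define h where "h = (1 / d) *\<^sub>R sum a F"
    have hV: "h \<in> V"
      unfolding h_def a_def by (intro subspace_scale subspace_sum V)
    have aa: "inner (a k) (a l) = (if k = l then d * (cmod (ell2_nth q k))\<^sup>2 else 0)" for k l
    proof -
      have "inner (a k) (a l) = inner q (ell2_shift (k - l) (ell2_nth q k * cnj (ell2_nth q l)) q)"
        by (simp add: a_def inner_ell2_shift_left ell2_shift_shift)
      also have "\<dots> = (if k = l then d * (cmod (ell2_nth q k))\<^sup>2 else 0)"
        by (auto simp: orth' d_def power2_norm_eq_inner complex_norm_square[symmetric]
            ell2_shift_0_of_real simp del: of_real_power)
      finally show ?thesis .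
    qed
    have "inner ell2_unit (a k) = (cmod (ell2_nth q k))\<^sup>2" for k
      by (simp add: inner_ell2_unit a_def ell2_shift.rep_eq complex_mult_cnj cmod_power2 mult.commute
          flip: power2_eq_square)
    hence "inner ell2_unit (sum a F) = s"
      by (simp add: inner_sum_right s_def)
    moreover have "inner (sum a F) (sum a F) = d * s"
      using F(1) by (simp add: inner_sum_left inner_sum_right aa s_def sum_distrib_left)
    moreover have "inner ell2_unit ell2_unit = 1"
      by (simp add: inner_ell2_unit ell2_unit.rep_eq)
    ultimately have "inner ell2_unit ell2_unit = 1" "inner ell2_unit h = s / d" "inner h h = s / d"
      using d by (auto simp: h_def)
    hence "(norm (ell2_unit - h))\<^sup>2 = 1 - s / d"
      unfolding power2_norm_eq_inner by (simp add: inner_diff_left inner_diff_right inner_commute[of h ell2_unit])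
    also have "\<dots> \<le> (e / 2)\<^sup>2"
      using s d by (simp add: field_simps)
    finally have "norm (ell2_unit - h) \<le> e / 2"
      by (rule power2_le_imp_le) (use e in auto)
    thus "\<exists>y\<in>V. dist y ell2_unit < e"
      using e hV by (intro bexI[of _ h]) (auto simp: dist_norm norm_minus_commute)
  qed
  thus ?thesis using V by simp
qed

text \<open>Write \<open>g = p + q\<close> with \<open>p\<close> in the closed span \<open>W\<close> of the forward translates of \<open>g\<close> and \<open>q\<close>
  orthogonal to \<open>W\<close>. The translates of \<open>q\<close> are orthogonal, and \<open>q\<close> does not vanish at the
  first index where \<open>g\<close> does not, since all elements of \<open>W\<close> vanish there.\<close>

lemma ell2_unit_mem_if_shifts:
  assumes V: "closed V" "subspace V" "\<And>n c. ell2_shift n c g \<in> V"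
    and g: "g \<noteq> 0" "\<And>k. k < N \<Longrightarrow> ell2_nth g k = 0"
  shows "ell2_unit \<in> V"
proof -
  obtain i where i: "ell2_nth g i \<noteq> 0"
    using g(1) ell2_eqI[of g 0] by (auto simp: ell2_nth_simps)
  define m where "m = (LEAST m. ell2_nth g (N + int m) \<noteq> 0)"
  have "i \<ge> N" using i g(2) by (meson not_le)
  hence "\<exists>m. ell2_nth g (N + int m) \<noteq> 0"
    using i by (intro exI[of _ "nat (i - N)"]) auto
  hence m: "ell2_nth g (N + int m) \<noteq> 0"
    unfolding m_def by (rule LeastI_ex)
  have below: "ell2_nth g k = 0" if "k < N + int m" for k
  proof (cases "k < N")
    case False
    hence "nat (k - N) < m" using that by auto
    from not_less_Least[OF this[unfolded m_def]] show ?thesis using False by auto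
  qed (rule g(2))
  \<comment> \<open>Strictly forward translates: with \<open>n = 0\<close> allowed, \<open>g\<close>
    itself would lie in \<open>W\<close> and \<open>q\<close> would be 0.\<close>
  define B where "B = {ell2_shift n c g | n c. n \<ge> 1}"
  define W where "W = closure (span B)"
  have W: "closed W" "subspace W"
    by (auto simp: W_def intro: subspace_closure_real_normed)
  have B_W: "B \<subseteq> W"
    unfolding W_def using span_superset closure_subset by blast
  have shift_W: "ell2_shift n c w \<in> W" if w: "w \<in> W" and n: "n \<ge> 1" for n c w
  proof -
    interpret bounded_linear "ell2_shift n c" by (rule bounded_linear_ell2_shift)
    have "ell2_shift n c ` closure (span B) \<subseteq> closure (ell2_shift n c ` span B)"
      by (rule closure_bounded_linear_image_subset) unfold_locales
    also have "ell2_shift n c ` span B = span (ell2_shift n c ` B)"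
      by (rule linear_span_image[symmetric]) unfold_locales
    also have "\<dots> \<subseteq> span B"
      using n by (intro span_mono) (fastforce simp: B_def ell2_shift_shift)
    finally show ?thesis using w unfolding W_def
      by (meson closure_mono image_subset_iff order_trans subsetD)
  qed
  obtain p where p: "p \<in> W" "\<And>w. w \<in> W \<Longrightarrow> inner (g - p) w = 0"
    using orthogonal_projection_exists[OF W, of g] by blast
  define q where "q = g - p"
  have "W \<subseteq> {w. ell2_nth w (N + int m) = 0}"
    unfolding W_def
  proof (intro closure_minimal span_minimal)
    interpret bounded_linear "\<lambda>w. ell2_nth w (N + int m)" by (rule bounded_linear_ell2_nth)
    show "subspace {w. ell2_nth w (N + int m) = 0}"
      by (auto simp: subspace_def add scale)
    show "closed {w. ell2_nth w (N + int m) = 0}"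
      by (intro closed_Collect_eq continuous_on continuous_intros)
  qed (auto simp: B_def ell2_shift.rep_eq below)
  hence "q \<noteq> 0"
    using p(1) m by (auto simp: q_def)
  \<comment> \<open>\<open>q\<close> is orthogonal to \<open>W\<close>, and its forward translates
    lie in \<open>W\<close>: those of \<open>g\<close> are generators and those of \<open>p\<close>
    stay in \<open>W\<close>.\<close>
  moreover have "inner q (ell2_shift n c q) = 0" if n: "n \<ge> 1" for n c
  proof -
    have "ell2_shift n c g \<in> W" using n B_W by (auto simp: B_def)
    hence "ell2_shift n c q \<in> W"
      unfolding q_def using shift_W[OF p(1) n, of c]
      by (simp add: linear_diff[OF bounded_linear.linear[OF bounded_linear_ell2_shift]]
          subspace_diff[OF W(2)])
    thus ?thesis unfolding q_def by (rule p(2))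
  qed
  moreover have "ell2_shift n c q \<in> V" for n c
  proof -
    have "B \<subseteq> V" using V(3) by (auto simp: B_def)
    hence "W \<subseteq> V" unfolding W_def by (intro closure_minimal span_minimal V)
    \<comment> \<open>Here \<open>n\<close> may be negative, so translates of \<open>W\<close> can
      leave \<open>W\<close>; they stay in \<open>V\<close> because those of the generators
      do.\<close>
    have "ell2_shift n c w \<in> V" if "w \<in> W" for w
    proof -
      interpret bounded_linear "ell2_shift n c" by (rule bounded_linear_ell2_shift)
      have "ell2_shift n c ` closure (span B) \<subseteq> closure (ell2_shift n c ` span B)"
        by (rule closure_bounded_linear_image_subset) unfold_locales
      also have "ell2_shift n c ` span B = span (ell2_shift n c ` B)"
        by (rule linear_span_image[symmetric]) unfold_locales
      also have "closure \<dots> \<subseteq> V"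
        by (intro closure_minimal span_minimal V) (auto simp: B_def ell2_shift_shift V(3))
      finally show ?thesis using that unfolding W_def by blast
    qed
    from this[OF p(1)] show ?thesis
      unfolding q_def using V(3)[of n c]
      by (simp add: linear_diff[OF bounded_linear.linear[OF bounded_linear_ell2_shift]]
          subspace_diff[OF V(2)])
  qed
  ultimately show ?thesis
    using ell2_unit_mem_if_shifts_orthogonal[OF V(1,2)] by blast
qed

text \<open>For countable \<open>D\<close> the coefficient lists form one countable set of
  candidates that serves all sequences \<open>g\<close> at once; the measurable choice between
  fibres rests on this. With lists, sums of candidates are concatenations.\<close>

lemma ell2_unit_in_closure_shifts:
  assumes D: "closure D = (UNIV :: complex set)"
    and g: "g \<noteq> 0" "\<And>k. k < N \<Longrightarrow> ell2_nth g k = 0"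
  shows "ell2_unit \<in> closure {\<Sum>(n, c)\<leftarrow>l. ell2_shift n c g | l. set l \<subseteq> UNIV \<times> D}" (is "_ \<in> closure ?S")
proof (rule ell2_unit_mem_if_shifts[OF _ _ _ g])
  have add: "x + y \<in> closure ?S" if "x \<in> closure ?S" "y \<in> closure ?S" for x y
    using that
  proof (rule closure_add_mem)
    fix u v assume "u \<in> ?S" "v \<in> ?S"
    then obtain l l' where "u = (\<Sum>(n, c)\<leftarrow>l. ell2_shift n c g)" "set l \<subseteq> UNIV \<times> D"
      "v = (\<Sum>(n, c)\<leftarrow>l'. ell2_shift n c g)" "set l' \<subseteq> UNIV \<times> D" by blast
    thus "u + v \<in> ?S" by (auto intro!: exI[of _ "l @ l'"])
  qed
  have shift: "ell2_shift n c g \<in> closure ?S" for n c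
  proof -
    interpret bounded_linear "\<lambda>c. ell2_shift n c g" by (rule bounded_linear_ell2_shift_coeff)
    have "ell2_shift n c g \<in> (\<lambda>c. ell2_shift n c g) ` closure D" by (simp add: D)
    also have "\<dots> \<subseteq> closure ((\<lambda>c. ell2_shift n c g) ` D)"
      by (rule closure_bounded_linear_image_subset) unfold_locales
    also have "\<dots> \<subseteq> closure ?S"
    proof (intro closure_mono subsetI)
      fix x assume "x \<in> (\<lambda>c. ell2_shift n c g) ` D"
      then obtain c where "c \<in> D" "x = ell2_shift n c g" by blast
      thus "x \<in> ?S" by (auto intro!: exI[of _ "[(n, c)]"])
    qed
    finally show ?thesis .
  qed
  thus "\<And>n c. ell2_shift n c g \<in> closure ?S" .
  show "subspace (closure ?S)"
  proof (rule subspaceI)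
    show "0 \<in> closure ?S" 
      by (rule subsetD[OF closure_subset]) (auto intro!: exI[of _ "[]"])
    fix r :: real and x assume x: "x \<in> closure ?S"
    have "r *\<^sub>R x \<in> (*\<^sub>R) r ` closure ?S" using x by blast
    also have "\<dots> \<subseteq> closure ((*\<^sub>R) r ` ?S)"
      by (rule closure_bounded_linear_image_subset[OF bounded_linear_scaleR_right])
    also have "\<dots> \<subseteq> closure ?S"
    proof (intro closure_minimal closed_closure subsetI)
      \<comment> \<open>Coefficients \<open>r * c\<close> may leave \<open>D\<close>, so the sum is
        put into the closure term by term with \<open>shift\<close> and \<open>add\<close> instead
        of being matched by another list.\<close>
      have "r *\<^sub>R (\<Sum>(n, c)\<leftarrow>l. ell2_shift n c g) \<in> closure ?S" for l
      proof (induction l)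
        case Nil
        show ?case using \<open>0 \<in> closure ?S\<close> by simp
      next
        case (Cons nc l)
        obtain n c where nc: "nc = (n, c)" by (cases nc)
        have "r *\<^sub>R ell2_shift n c g = ell2_shift n (of_real r * c) g"
          by (rule ell2_eqI) (simp add: ell2_shift.rep_eq ell2_nth_simps scaleR_conv_of_real)
        with Cons add[OF shift Cons] show ?case by (simp add: nc scaleR_add_right)
      qed
      thus "x \<in> closure ?S" if "x \<in> (*\<^sub>R) r ` ?S" for x using that by blast
    qed
    finally show "r *\<^sub>R x \<in> closure ?S" .
  qed (rule add)
qed auto

subsection \<open>Closed subspaces of \<open>L\<^sup>2(\<real>)\<close>\<close>

text \<open>An \<open>ennreal\<close> integral: for measurable functions finiteness of
  \<open>L2_sq\<close> is membership in \<open>L2\<close>, so one estimate gives both membership and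
  size.\<close>

definition L2_sq :: "(real \<Rightarrow> complex) \<Rightarrow> ennreal" where
  "L2_sq f = (\<integral>\<^sup>+x. ennreal ((cmod (f x))\<^sup>2) \<partial>lebesgue)"

lemma L2_iff: "f \<in> L2 \<longleftrightarrow> f \<in> borel_measurable lebesgue \<and> L2_sq f < \<infinity>"
  by (auto simp: L2_def L2_sq_def integrable_iff_bounded)

lemma L2_measurable: "f \<in> L2 \<Longrightarrow> f \<in> borel_measurable lebesgue"
  by (simp add: L2_iff)

lemma L2_norm_less_iff:
  assumes "f \<in> L2" "e > 0"
  shows "L2_norm f < e \<longleftrightarrow> L2_sq f < ennreal (e\<^sup>2)"
proof -
  have "L2_sq f = ennreal (LINT x|lebesgue. (cmod (f x))\<^sup>2)"
    unfolding L2_sq_def using assms by (intro nn_integral_eq_integral) (auto simp: L2_def)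
  moreover have "L2_norm f < e \<longleftrightarrow> (LINT x|lebesgue. (cmod (f x))\<^sup>2) < e\<^sup>2"
    using assms(2) unfolding L2_norm_def by (metis less_le real_less_lsqrt real_less_rsqrt
      real_sqrt_abs real_sqrt_less_iff abs_of_pos)
  ultimately show ?thesis
    using assms(2) by (simp add: ennreal_less_iff)
qed

lemma L2_sq_mono:
  assumes "\<And>x. cmod (f x) \<le> cmod (g x)"
  shows "L2_sq f \<le> L2_sq g"
  unfolding L2_sq_def by (intro nn_integral_mono ennreal_leI power_mono assms) auto

lemma L2_sq_cmult:
  assumes "f \<in> borel_measurable lebesgue"
  shows "L2_sq (\<lambda>x. c * f x) = ennreal ((cmod c)\<^sup>2) * L2_sq f"
  using assms by (simp add: L2_sq_def norm_mult power_mult_distrib ennreal_mult nn_integral_cmult)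

lemma L2_sq_add:
  assumes [measurable]: "f \<in> borel_measurable lebesgue" "g \<in> borel_measurable lebesgue"
  shows "L2_sq (\<lambda>x. f x + g x) \<le> 2 * L2_sq f + 2 * L2_sq g"
proof -
  have "L2_sq (\<lambda>x. f x + g x)
      \<le> (\<integral>\<^sup>+x. 2 * ennreal ((cmod (f x))\<^sup>2) + 2 * ennreal ((cmod (g x))\<^sup>2) \<partial>lebesgue)"
    unfolding L2_sq_def
  proof (rule nn_integral_mono)
    fix x
    have "ennreal ((cmod (f x + g x))\<^sup>2) \<le> ennreal (2 * (cmod (f x))\<^sup>2 + 2 * (cmod (g x))\<^sup>2)"
      by (intro ennreal_leI norm_add_squared_le)
    also have "\<dots> = 2 * ennreal ((cmod (f x))\<^sup>2) + 2 * ennreal ((cmod (g x))\<^sup>2)"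
      by (simp add: ennreal_mult')
    finally show "ennreal ((cmod (f x + g x))\<^sup>2) \<le> \<dots>" .
  qed
  also have "\<dots> = 2 * L2_sq f + 2 * L2_sq g"
    by (simp add: L2_sq_def nn_integral_add nn_integral_cmult)
  finally show ?thesis .
qed

lemma L2_cmult: "f \<in> L2 \<Longrightarrow> (\<lambda>x. c * f x) \<in> L2"
  by (auto simp: L2_iff L2_sq_cmult ennreal_mult_less_top)

lemma L2_add:
  assumes "f \<in> L2" "g \<in> L2"
  shows "(\<lambda>x. f x + g x) \<in> L2"
  using assms le_less_trans[OF L2_sq_add[of f g]]
  by (auto simp: L2_iff ennreal_mult_less_top)

lemma L2_diff: "f \<in> L2 \<Longrightarrow> g \<in> L2 \<Longrightarrow> (\<lambda>x. f x - g x) \<in> L2"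
  using L2_add[of f "\<lambda>x. -1 * g x"] L2_cmult[of g "-1"] by simp

lemma L2_zero: "(\<lambda>x. 0) \<in> L2"
  by (simp add: L2_iff L2_sq_def)

lemma L2_bounded:
  assumes "f \<in> borel_measurable lebesgue" "g \<in> L2" "\<And>x. cmod (f x) \<le> cmod (g x)"
  shows "f \<in> L2"
  using assms le_less_trans[OF L2_sq_mono[of f g]] by (auto simp: L2_iff)

text \<open>The quarters pay for the factors 2 in \<open>L2_sq_add\<close>, which stands in for the
  triangle inequality when squared norms are used.\<close>

lemma L2_sq_triangle_less:
  assumes "f \<in> L2" "g \<in> L2" "h \<in> L2" and e: "e > 0"
    and "L2_sq (\<lambda>x. f x - g x) < ennreal (e / 4)" "L2_sq (\<lambda>x. g x - h x) < ennreal (e / 4)"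
  shows "L2_sq (\<lambda>x. f x - h x) < ennreal e"
proof -
  have "L2_sq (\<lambda>x. f x - h x) \<le> 2 * L2_sq (\<lambda>x. f x - g x) + 2 * L2_sq (\<lambda>x. g x - h x)"
    using L2_sq_add[of "\<lambda>x. f x - g x" "\<lambda>x. g x - h x"] assms by (auto simp: L2_iff)
  also have "\<dots> < 2 * ennreal (e / 4) + 2 * ennreal (e / 4)"
    using assms by (intro add_strict_mono ennreal_mult_strict_left_mono) auto
  also have "2 * ennreal (e / 4) = ennreal (e / 2)"
    using ennreal_mult'[of 2 "e / 4"] by simp
  also have "ennreal (e / 2) + ennreal (e / 2) = ennreal e"
    using e by (simp flip: ennreal_plus)
  finally show ?thesis .
qed

section \<open>Linear spans and their closures\<close>

lemma linear_span_add:
  assumes "f \<in> linear_span S" "g \<in> linear_span S"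
  shows "(\<lambda>x. f x + g x) \<in> linear_span S"
proof -
  obtain F c where F: "finite F" "F \<subseteq> S" "f = (\<lambda>x. \<Sum>s\<in>F. c s * s x)"
    using assms(1) by (auto simp: linear_span_def)
  obtain G d where G: "finite G" "G \<subseteq> S" "g = (\<lambda>x. \<Sum>s\<in>G. d s * s x)"
    using assms(2) by (auto simp: linear_span_def)
  define b where "b s = (if s \<in> F then c s else 0) + (if s \<in> G then d s else 0)" for s
  have "f x + g x = (\<Sum>s\<in>F \<union> G. b s * s x)" for x
  proof -
    have "f x = (\<Sum>s\<in>F \<union> G. (if s \<in> F then c s else 0) * s x)"
      unfolding F(3) using F(1) G(1) by (intro sum.mono_neutral_cong_left) auto
    moreover have "g x = (\<Sum>s\<in>F \<union> G. (if s \<in> G then d s else 0) * s x)"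
      unfolding G(3) using F(1) G(1) by (intro sum.mono_neutral_cong_left) auto
    ultimately show ?thesis
      by (simp only: b_def sum.distrib distrib_right)
  qed
  thus ?thesis unfolding linear_span_def using F G by blast
qed

lemma linear_span_cmult:
  assumes "f \<in> linear_span S"
  shows "(\<lambda>x. c * f x) \<in> linear_span S"
proof -
  obtain F d where F: "finite F" "F \<subseteq> S" "f = (\<lambda>x. \<Sum>s\<in>F. d s * s x)"
    using assms by (auto simp: linear_span_def)
  have "(\<lambda>x. c * f x) = (\<lambda>x. \<Sum>s\<in>F. (c * d s) * s x)"
    by (simp add: F(3) sum_distrib_left mult.assoc)
  thus ?thesis unfolding linear_span_def using F by (auto intro!: exI[of _ F] exI[of _ "\<lambda>s. c * d s"])
qed

lemma linear_span_base: "s \<in> S \<Longrightarrow> s \<in> linear_span S"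
  unfolding linear_span_def by (auto intro!: exI[of _ "{s}"] exI[of _ "\<lambda>_. 1"])

lemma linear_span_induct [consumes 1, case_names zero add cmult base]:
  assumes "f \<in> linear_span S"
    and zero: "P (\<lambda>x. 0)"
    and add: "\<And>f g. P f \<Longrightarrow> P g \<Longrightarrow> P (\<lambda>x. f x + g x)"
    and cmult: "\<And>c f. P f \<Longrightarrow> P (\<lambda>x. c * f x)"
    and base: "\<And>s. s \<in> S \<Longrightarrow> P s"
  shows "P f"
proof -
  obtain F c where F: "finite F" "F \<subseteq> S" and f: "f = (\<lambda>x. \<Sum>s\<in>F. c s * s x)"
    using assms(1) by (auto simp: linear_span_def)
  from F have "P (\<lambda>x. \<Sum>s\<in>F. c s * s x)"
    by (induction F rule: finite_induct) (auto intro: zero add[OF cmult[OF base]])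
  thus ?thesis by (simp add: f)
qed

lemma linear_span_zero: "(\<lambda>x. 0) \<in> linear_span S"
  unfolding linear_span_def by (auto intro!: exI[of _ "{}"])

lemma linear_span_subset_L2: "S \<subseteq> L2 \<Longrightarrow> linear_span S \<subseteq> L2"
  by (auto elim!: linear_span_induct intro: L2_zero L2_add L2_cmult)

lemma L2_closure_iff:
  assumes "S \<subseteq> L2"
  shows "f \<in> L2_closure S \<longleftrightarrow> f \<in> L2 \<and> (\<forall>e>0. \<exists>h\<in>S. L2_sq (\<lambda>x. f x - h x) < ennreal e)"
proof -
  have "(\<forall>e>0. \<exists>h\<in>S. L2_norm (\<lambda>x. f x - h x) < e) \<longleftrightarrow>
      (\<forall>e>0. \<exists>h\<in>S. L2_sq (\<lambda>x. f x - h x) < ennreal e)" if f: "f \<in> L2"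
  proof -
    have *: "L2_norm (\<lambda>x. f x - h x) < e \<longleftrightarrow> L2_sq (\<lambda>x. f x - h x) < ennreal (e\<^sup>2)"
      if "h \<in> S" "e > 0" for h e
      using that assms f by (intro L2_norm_less_iff L2_diff) auto
    show ?thesis
    proof safe
      fix e :: real
      assume e: "e > 0" and "\<forall>e>0. \<exists>h\<in>S. L2_norm (\<lambda>x. f x - h x) < e"
      then obtain h where "h \<in> S" "L2_norm (\<lambda>x. f x - h x) < sqrt e"
        by (metis real_sqrt_gt_zero)
      thus "\<exists>h\<in>S. L2_sq (\<lambda>x. f x - h x) < ennreal e"
        using *[of h "sqrt e"] e by auto
    next
      fix e :: real
      assume e: "e > 0" and "\<forall>e>0. \<exists>h\<in>S. L2_sq (\<lambda>x. f x - h x) < ennreal e"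
      then obtain h where "h \<in> S" "L2_sq (\<lambda>x. f x - h x) < ennreal (e\<^sup>2)"
        by (metis zero_less_power)
      thus "\<exists>h\<in>S. L2_norm (\<lambda>x. f x - h x) < e"
        using *[of h e] e by auto
    qed
  qed
  thus ?thesis by (auto simp: L2_closure_def)
qed

text \<open>Elements are functions, not classes. Closedness in the seminorm makes \<open>V\<close>
  stable under measurable changes on null sets, see \<open>AE_eq\<close>.\<close>

locale closed_L2_subspace =
  fixes V :: "(real \<Rightarrow> complex) set"
  assumes subset_L2: "V \<subseteq> L2"
    and zero: "(\<lambda>x. 0) \<in> V"
    and add: "f \<in> V \<Longrightarrow> h \<in> V \<Longrightarrow> (\<lambda>x. f x + h x) \<in> V"
    and cmult: "f \<in> V \<Longrightarrow> (\<lambda>x. c * f x) \<in> V"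
    and closed: "f \<in> L2 \<Longrightarrow> (\<And>e. e > 0 \<Longrightarrow> \<exists>h\<in>V. L2_sq (\<lambda>x. f x - h x) < ennreal e) \<Longrightarrow> f \<in> V"

lemma closed_L2_subspace_closure:
  assumes S: "S \<subseteq> L2"
  shows "closed_L2_subspace (L2_closure (linear_span S))"
proof
  have span: "linear_span S \<subseteq> L2" by (rule linear_span_subset_L2[OF S])
  note iff = L2_closure_iff[OF span]
  show "L2_closure (linear_span S) \<subseteq> L2" by (auto simp: L2_closure_def)
  show "(\<lambda>x. 0) \<in> L2_closure (linear_span S)"
    unfolding iff using L2_zero linear_span_zero[of S]
    by (auto intro!: bexI[of _ "\<lambda>x. 0"] simp: L2_sq_def)
  show "(\<lambda>x. f x + h x) \<in> L2_closure (linear_span S)"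
    if f: "f \<in> L2_closure (linear_span S)" and h: "h \<in> L2_closure (linear_span S)" for f h
    unfolding iff
  proof safe
    show "(\<lambda>x. f x + h x) \<in> L2" using f h unfolding iff by (auto intro: L2_add)
    fix e :: real assume e: "e > 0"
    hence "e / 4 > 0" by simp
    then obtain f' h' where f': "f' \<in> linear_span S" "L2_sq (\<lambda>x. f x - f' x) < ennreal (e / 4)"
      and h': "h' \<in> linear_span S" "L2_sq (\<lambda>x. h x - h' x) < ennreal (e / 4)"
      using f h unfolding iff by meson
    have L2: "f \<in> L2" "h \<in> L2" "f' \<in> L2" "h' \<in> L2"
      using f h f' h' span unfolding iff by auto
    have "L2_sq (\<lambda>x. (f x + h x) - (f' x + h' x)) < ennreal e"
    proof (rule L2_sq_triangle_less[where g = "\<lambda>x. f' x + h x"])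
      show "L2_sq (\<lambda>x. f x + h x - (f' x + h x)) < ennreal (e / 4)"
        "L2_sq (\<lambda>x. f' x + h x - (f' x + h' x)) < ennreal (e / 4)"
        using f'(2) h'(2) by (simp_all add: algebra_simps)
    qed (use L2 e in \<open>auto intro: L2_add\<close>)
    moreover have "(\<lambda>x. f' x + h' x) \<in> linear_span S"
      using f' h' by (intro linear_span_add)
    ultimately show "\<exists>g\<in>linear_span S. L2_sq (\<lambda>x. f x + h x - g x) < ennreal e"
      by (intro bexI[of _ "\<lambda>x. f' x + h' x"])
  qed
  show "(\<lambda>x. c * f x) \<in> L2_closure (linear_span S)" if f: "f \<in> L2_closure (linear_span S)" for f c
    unfolding iff
  proof safe
    show "(\<lambda>x. c * f x) \<in> L2" using f unfolding iff by (auto intro: L2_cmult)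
    fix e :: real assume e: "e > 0"
    \<comment> \<open>The summand 1 keeps \<open>C\<close> positive for
      \<open>c = 0\<close>.\<close>
    define C where "C = (cmod c)\<^sup>2 + 1"
    have C: "C > 0" by (simp add: C_def add_nonneg_pos)
    with e have "e / C > 0" by simp
    then obtain f' where f': "f' \<in> linear_span S" "L2_sq (\<lambda>x. f x - f' x) < ennreal (e / C)"
      using f unfolding iff by meson
    have "f \<in> L2" "f' \<in> L2"
      using f f' span unfolding iff by auto
    hence "L2_sq (\<lambda>x. c * f x - c * f' x) = ennreal ((cmod c)\<^sup>2) * L2_sq (\<lambda>x. f x - f' x)"
      by (subst L2_sq_cmult[symmetric]) (auto simp: algebra_simps L2_iff)
    also have "\<dots> \<le> ennreal C * L2_sq (\<lambda>x. f x - f' x)"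
      by (intro mult_right_mono ennreal_leI) (auto simp: C_def)
    also have "\<dots> < ennreal C * ennreal (e / C)"
      using f'(2) C by (intro ennreal_mult_strict_left_mono) auto
    also have "\<dots> = ennreal e" using C e by (simp flip: ennreal_mult)
    finally show "\<exists>g\<in>linear_span S. L2_sq (\<lambda>x. c * f x - g x) < ennreal e"
      by (intro bexI[of _ "\<lambda>x. c * f' x"] linear_span_cmult f'(1))
  qed
  show "f \<in> L2_closure (linear_span S)" if f: "f \<in> L2"
    and approx: "\<And>e. e > 0 \<Longrightarrow> \<exists>h\<in>L2_closure (linear_span S). L2_sq (\<lambda>x. f x - h x) < ennreal e" for f
    unfolding iff
  proof safe
    fix e :: real assume e: "e > 0"
    hence e4: "e / 4 > 0" by simp
    from approx[OF this] obtain h where h: "h \<in> L2_closure (linear_span S)"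
      "L2_sq (\<lambda>x. f x - h x) < ennreal (e / 4)" by blast
    then obtain h' where h': "h' \<in> linear_span S" "L2_sq (\<lambda>x. h x - h' x) < ennreal (e / 4)"
      using e4 unfolding iff by meson
    have "h \<in> L2" "h' \<in> L2" using h h' span unfolding iff by auto
    from L2_sq_triangle_less[OF f this e h(2) h'(2)]
    show "\<exists>g\<in>linear_span S. L2_sq (\<lambda>x. f x - g x) < ennreal e"
      using h' by blast
  qed (rule f)
qed

section \<open>Dominated limits and null sets in a closed subspace\<close>

context closed_L2_subspace
begin

lemma sum: "(\<And>i. i \<in> I \<Longrightarrow> h i \<in> V) \<Longrightarrow> (\<lambda>x. \<Sum>i\<in>I. h i x) \<in> V"
  by (induction I rule: infinite_finite_induct) (auto intro: zero add)

text \<open>Dominated convergence turns pointwise convergence into convergence in \<open>L2\<close>.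
  Limits of multipliers, of the glued functions below and of simple functions are all handled
  through this.\<close>

lemma dominated_limit:
  assumes h: "\<And>i. h i \<in> V" and f: "f \<in> borel_measurable lebesgue" and w: "w \<in> L2"
    and le: "\<And>i. AE x in lebesgue. cmod (h i x) \<le> cmod (w x)"
    and lim: "AE x in lebesgue. (\<lambda>i. h i x) \<longlonglongrightarrow> f x"
  shows "f \<in> V"
proof -
  have [measurable]: "h i \<in> borel_measurable lebesgue" "f \<in> borel_measurable lebesgue"
    "w \<in> borel_measurable lebesgue" for i
    using h subset_L2 f w by (auto intro: L2_measurable)
  have f_le: "AE x in lebesgue. cmod (f x) \<le> cmod (w x)"
  proof -
    have "AE x in lebesgue. \<forall>i. cmod (h i x) \<le> cmod (w x)"
      using le by (simp add: AE_all_countable)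
    with lim show ?thesis
    proof eventually_elim
      case (elim x)
      show ?case
        by (rule tendsto_upperbound[OF tendsto_norm[OF elim(1)]]) (use elim(2) in auto)
    qed
  qed
  have "L2_sq f \<le> L2_sq w"
    unfolding L2_sq_def by (intro nn_integral_mono_AE) (use f_le in \<open>auto elim!: eventually_mono
      intro!: ennreal_leI power_mono\<close>)
  hence fL2: "f \<in> L2" using f w by (auto simp: L2_iff)
  have "(\<lambda>i. L2_sq (\<lambda>x. f x - h i x)) \<longlonglongrightarrow> (\<integral>\<^sup>+x. 0 \<partial>(lebesgue :: real measure))"
    unfolding L2_sq_def
  \<comment> \<open>The difference \<open>f x - h j x\<close> is bounded by \<open>2 * w x\<close>,
    as the limit inherits the bound on the \<open>h j\<close>.\<close>
  proof (rule nn_integral_dominated_convergence[where u' = "\<lambda>_. 0" and w = "\<lambda>x. ennreal ((cmod (2 * w x))\<^sup>2)"])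
    show "AE x in lebesgue. ennreal ((cmod (f x - h j x))\<^sup>2) \<le> ennreal ((cmod (2 * w x))\<^sup>2)" for j
      using le[of j] f_le
    proof eventually_elim
      case (elim x)
      show ?case using norm_triangle_ineq4[of "f x" "h j x"] elim
        by (intro ennreal_leI power_mono) (auto simp: norm_mult)
    qed
    show "(\<integral>\<^sup>+x. ennreal ((cmod (2 * w x))\<^sup>2) \<partial>lebesgue) < \<infinity>"
      using L2_cmult[OF w, of 2] by (simp add: L2_iff L2_sq_def)
    show "AE x in lebesgue. (\<lambda>i. ennreal ((cmod (f x - h i x))\<^sup>2)) \<longlonglongrightarrow> 0"
      using lim
    proof eventually_elim
      case (elim x)
      have "(\<lambda>i. ennreal ((cmod (f x - h i x))\<^sup>2)) \<longlonglongrightarrow> ennreal ((cmod (f x - f x))\<^sup>2)"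
        by (intro tendsto_intros elim)
      thus ?case by simp
    qed
  qed auto
  hence lim0: "(\<lambda>i. L2_sq (\<lambda>x. f x - h i x)) \<longlonglongrightarrow> 0" by simp
  show ?thesis
  proof (rule closed[OF fL2])
    fix e :: real assume "e > 0"
    hence "\<forall>\<^sub>F i in sequentially. L2_sq (\<lambda>x. f x - h i x) < ennreal e"
      by (intro order_tendstoD(2)[OF lim0]) auto
    then obtain i where "L2_sq (\<lambda>x. f x - h i x) < ennreal e"
      by (auto simp: eventually_sequentially)
    thus "\<exists>h\<in>V. L2_sq (\<lambda>x. f x - h x) < ennreal e" using h by blast
  qed
qed

lemma AE_eq:
  assumes "f \<in> V" "h \<in> borel_measurable lebesgue" "AE x in lebesgue. f x = h x"
  shows "h \<in> V"
proof (rule dominated_limit[where h = "\<lambda>_. f" and w = f])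
  show "AE x in lebesgue. (\<lambda>i :: nat. f x) \<longlonglongrightarrow> h x"
    using assms(3) by eventually_elim simp
qed (use assms subset_L2 in auto)

subsection \<open>Multipliers\<close>

definition multiplier :: "(real \<Rightarrow> complex) \<Rightarrow> bool" where
  "multiplier u \<longleftrightarrow> (\<forall>f\<in>V. (\<lambda>x. u x * f x) \<in> V)"

lemma multiplierD: "multiplier u \<Longrightarrow> f \<in> V \<Longrightarrow> (\<lambda>x. u x * f x) \<in> V"
  by (simp add: multiplier_def)

lemma multiplier_const: "multiplier (\<lambda>x. c)"
  by (auto simp: multiplier_def intro: cmult)

lemma multiplier_add: "multiplier u \<Longrightarrow> multiplier v \<Longrightarrow> multiplier (\<lambda>x. u x + v x)"
  by (auto simp: multiplier_def distrib_right intro: add)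

lemma multiplier_mult: "multiplier u \<Longrightarrow> multiplier v \<Longrightarrow> multiplier (\<lambda>x. u x * v x)"
  by (simp add: multiplier_def mult.assoc)

lemma multiplier_diff: "multiplier u \<Longrightarrow> multiplier v \<Longrightarrow> multiplier (\<lambda>x. u x - v x)"
  using multiplier_add[OF _ multiplier_mult[OF multiplier_const[of "-1"]]] by simp

text \<open>The majorant is \<open>C\<close> times \<open>f\<close>; measurability of the product
  with \<open>v\<close> comes from the products with the \<open>u i\<close>, which lie in
  \<open>V\<close>.\<close>

lemma multiplier_limit:
  assumes u: "\<And>i. multiplier (u i)" and bound: "\<And>i x. cmod (u i x) \<le> C"
    and lim: "\<And>x. (\<lambda>i. u i x) \<longlonglongrightarrow> v x"
  shows "multiplier v"
  unfolding multiplier_def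
proof
  fix f assume f: "f \<in> V"
  have uf: "(\<lambda>x. u i x * f x) \<in> V" for i by (rule multiplierD[OF u f])
  have lim': "(\<lambda>i. u i x * f x) \<longlonglongrightarrow> v x * f x" for x
    by (intro tendsto_intros lim)
  show "(\<lambda>x. v x * f x) \<in> V"
  proof (rule dominated_limit[where h = "\<lambda>i x. u i x * f x" and w = "\<lambda>x. of_real C * f x"])
    show "(\<lambda>x. v x * f x) \<in> borel_measurable lebesgue"
      by (rule borel_measurable_LIMSEQ_metric[OF _ lim']) (use uf subset_L2 in \<open>auto intro: L2_measurable\<close>)
    show "AE x in lebesgue. cmod (u i x * f x) \<le> cmod (of_real C * f x)" for i
      by (intro always_eventually allI)
        (auto simp: norm_mult intro!: mult_right_mono order_trans[OF bound])
  qed (use f subset_L2 lim' uf in \<open>auto intro: L2_cmult\<close>)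
qed

end

subsection \<open>Multipliers for modulation invariant subspaces\<close>

text \<open>The quotient map of the line onto the circle: 1-periodic functions of \<open>x\<close>
  are functions of \<open>circ x\<close>, which lets Stone-Weierstrass act on the compact
  circle.\<close>

definition circ :: "real \<Rightarrow> complex" where
  "circ x = exp (2 * of_real pi * \<i> * of_real x)"

lemma norm_circ [simp]: "cmod (circ x) = 1"
  by (simp add: circ_def norm_exp_eq_Re)

lemma modulation_1: "modulation 1 f = (\<lambda>x. circ x * f x)"
  by (simp add: modulation_def circ_def)

lemma modulation_minus_1: "modulation (- 1) f = (\<lambda>x. cnj (circ x) * f x)"
  by (simp add: modulation_def circ_def exp_cnj)

lemma circ_eq_iff: "circ x = circ y \<longleftrightarrow> (\<exists>n :: int. x = y + of_int n)"
proof -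
  have "2 * of_real pi * \<i> * of_real x = 2 * of_real pi * \<i> * of_real y + (of_int (2 * n) * pi) * \<i>
      \<longleftrightarrow> x = y + of_int n" for n :: int
  proof -
    have "2 * of_real pi * \<i> * of_real x - (2 * of_real pi * \<i> * of_real y + (of_int (2 * n) * pi) * \<i>)
        = 2 * of_real pi * \<i> * of_real (x - (y + of_int n))"
      by (simp add: algebra_simps)
    also have "\<dots> = 0 \<longleftrightarrow> x = y + of_int n"
      by (simp del: of_real_diff of_real_add)
    finally show ?thesis by (simp only: right_minus_eq)
  qed
  thus ?thesis unfolding circ_def exp_eq by simp
qed

lemma continuous_on_circ: "continuous_on A circ"
  unfolding circ_def by (intro continuous_intros)

text \<open>\<open>frac\<close> jumps at integers, while \<open>circ\<close> is continuous; sublevel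
  sets of \<open>frac\<close> thus become preimages of compact, hence closed, arcs.\<close>

lemma frac_le_iff_circ:
  assumes "0 \<le> t" "t < 1"
  shows "frac x \<le> t \<longleftrightarrow> circ x \<in> circ ` {0..t}"
proof
  assume "frac x \<le> t"
  moreover have "circ x = circ (frac x)"
    unfolding circ_eq_iff by (auto simp: frac_def intro: exI[of _ "\<lfloor>x\<rfloor>"])
  ultimately show "circ x \<in> circ ` {0..t}" by auto
next
  assume "circ x \<in> circ ` {0..t}"
  then obtain y n where "0 \<le> y" "y \<le> t" "x = y + of_int n"
    by (auto simp: circ_eq_iff)
  moreover from this assms have "frac x = y" by (simp add: frac_unique_iff)
  ultimately show "frac x \<le> t" by simp
qed

locale modulation_invariant_subspace = closed_L2_subspace +
  assumes modulation_1_mem: "f \<in> V \<Longrightarrow> modulation 1 f \<in> V"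
    and modulation_minus_1_mem: "f \<in> V \<Longrightarrow> modulation (- 1) f \<in> V"
begin

lemma multiplier_circ: "multiplier circ"
  using modulation_1_mem by (simp add: multiplier_def modulation_1)

lemma multiplier_cnj_circ: "multiplier (\<lambda>x. cnj (circ x))"
  using modulation_minus_1_mem by (simp add: multiplier_def modulation_minus_1)

text \<open>A real linear function of \<open>z\<close> is a combination of \<open>Re z\<close> and
  \<open>Im z\<close>, hence of \<open>z\<close> and \<open>cnj z\<close>; at
  \<open>z = circ x\<close> these two act as the modulations by 1 and -1.\<close>

lemma multiplier_polynomial:
  assumes "real_polynomial_function p"
  shows "multiplier (\<lambda>x. of_real (p (circ x)))"
  using assms
proof induction
  case (linear p)
  interpret bounded_linear p by fact
  have p: "p z = Re z * p 1 + Im z * p \<i>" for z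
  proof -
    have "z = Re z *\<^sub>R 1 + Im z *\<^sub>R \<i>" by (simp add: complex_eq_iff)
    hence "p z = p (Re z *\<^sub>R 1 + Im z *\<^sub>R \<i>)" by simp
    thus ?thesis by (simp only: add scaleR real_scaleR_def)
  qed
  have "of_real (p (circ x)) = of_real (p 1 / 2) * (circ x + cnj (circ x))
      + (- \<i> * of_real (p \<i> / 2)) * (circ x - cnj (circ x))" for x
    unfolding p[of "circ x"] complex_add_cnj complex_diff_cnj by (simp add: algebra_simps)
  thus ?case
    by (simp only:) (intro multiplier_add multiplier_diff multiplier_mult multiplier_const
        multiplier_circ multiplier_cnj_circ)
qed (auto intro: multiplier_const multiplier_add multiplier_mult)

text \<open>Stone-Weierstrass on the circle. The error \<open>1 / Suc n\<close> is at most 1, which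
  yields the uniform bound \<open>B + 1\<close> that \<open>multiplier_limit\<close> asks
  for.\<close>

lemma multiplier_continuous:
  assumes "continuous_on (sphere 0 1) v"
  shows "multiplier (\<lambda>x. of_real (v (circ x)))"
proof -
  have "\<exists>p. real_polynomial_function p \<and> (\<forall>z\<in>sphere 0 1. \<bar>v z - p z\<bar> < 1 / Suc n)" for n
    by (rule Stone_Weierstrass_real_polynomial_function[OF compact_sphere assms, of "1 / Suc n"])
      (simp, blast)
  then obtain p where p: "\<And>n. real_polynomial_function (p n)"
    "\<And>n z. z \<in> sphere 0 1 \<Longrightarrow> \<bar>v z - p n z\<bar> < 1 / Suc n" by metis
  obtain B where "\<forall>y\<in>v ` sphere 0 1. norm y \<le> B"
    using compact_imp_bounded[OF compact_continuous_image[OF assms compact_sphere]]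
    unfolding bounded_iff by blast
  hence B: "\<bar>v z\<bar> \<le> B" if "z \<in> sphere 0 1" for z
    using that by (metis imageI real_norm_def)
  show ?thesis
  proof (rule multiplier_limit[where C = "B + 1"])
    show "multiplier (\<lambda>x. of_real (p n (circ x)))" for n by (rule multiplier_polynomial[OF p(1)])
    show "cmod (of_real (p n (circ x))) \<le> B + 1" for n x
    proof -
      have "1 / real (Suc n) \<le> 1" by simp
      moreover have "\<bar>v (circ x) - p n (circ x)\<bar> < 1 / real (Suc n)" "\<bar>v (circ x)\<bar> \<le> B"
        using p(2) B by auto
      ultimately show ?thesis unfolding norm_of_real by linarith
    qed
    show "(\<lambda>n. complex_of_real (p n (circ x))) \<longlonglongrightarrow> of_real (v (circ x))" for x
    proof (rule tendsto_of_real, rule LIM_zero_cancel, rule Lim_null_comparison)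
      show "(\<lambda>n. 1 / real (Suc n)) \<longlonglongrightarrow> 0" by (rule LIMSEQ_Suc[OF lim_1_over_n])
      show "\<forall>\<^sub>F n in sequentially. norm (p n (circ x) - v (circ x)) \<le> 1 / real (Suc n)"
        using p(2)[of "circ x"] by (intro always_eventually allI) (auto simp: abs_minus_commute less_imp_le)
    qed
  qed
qed

lemma multiplier_closed:
  assumes "closed K"
  shows "multiplier (\<lambda>x. indicator K (circ x))"
\<comment> \<open>\<open>infdist\<close> to the empty set is 0 by convention, so the functions used
  for nonempty \<open>K\<close> would converge to 1 instead of 0.\<close>
proof (cases "K = {}")
  case False
  show ?thesis
  proof (rule multiplier_limit[where C = 1])
    show "multiplier (\<lambda>x. of_real (max 0 (1 - real n * infdist (circ x) K)))" for n
      by (rule multiplier_continuous) (intro continuous_intros)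
    show "(\<lambda>n. complex_of_real (max 0 (1 - real n * infdist (circ x) K))) \<longlonglongrightarrow> indicator K (circ x)" for x
    proof (cases "circ x \<in> K")
      case False
      hence d: "infdist (circ x) K > 0"
        using assms \<open>K \<noteq> {}\<close> by (simp add: infdist_pos_not_in_closed)
      obtain N where N: "real N * infdist (circ x) K > 1"
        using reals_Archimedean3[OF d] by blast
      have "max 0 (1 - real n * infdist (circ x) K) = 0" if "n \<ge> N" for n
      proof -
        have "real N * infdist (circ x) K \<le> real n * infdist (circ x) K"
          using that d by (intro mult_right_mono) auto
        thus ?thesis using N by simp
      qed
      thus ?thesis using False
        by (intro tendsto_eventually eventually_sequentiallyI[of N]) auto
    qed simp
    show "cmod (of_real (max 0 (1 - real n * infdist (circ x) K))) \<le> 1" for n x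
      by (simp add: infdist_nonneg)
  qed
qed (simp add: multiplier_const)

definition multiplier_sets :: "real set set" where
  "multiplier_sets = {A. multiplier (indicator A)}"

lemma sigma_algebra_multiplier_sets: "sigma_algebra UNIV multiplier_sets"
proof -
  have compl: "UNIV - A \<in> multiplier_sets" if "A \<in> multiplier_sets" for A
  proof -
    have "indicator (UNIV - A) = (\<lambda>x. 1 - indicator A x :: complex)"
      by (auto simp: indicator_def)
    thus ?thesis using that by (simp add: multiplier_sets_def multiplier_diff multiplier_const)
  qed
  have un: "A \<union> B \<in> multiplier_sets" if "A \<in> multiplier_sets" "B \<in> multiplier_sets" for A B
  proof -
    have "indicator (A \<union> B) = (\<lambda>x. indicator A x + indicator B x - indicator A x * indicator B x :: complex)"
      by (auto simp: indicator_def)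
    thus ?thesis using that
      by (simp add: multiplier_sets_def multiplier_diff multiplier_add multiplier_mult)
  qed
  have empty: "{} \<in> multiplier_sets"
    using multiplier_const[of 0] by (simp add: multiplier_sets_def indicator_def[abs_def])
  interpret algebra UNIV multiplier_sets
    using compl un empty by (auto simp: algebra_iff_Un)
  show ?thesis
  proof
    fix A :: "nat \<Rightarrow> real set" assume A: "range A \<subseteq> multiplier_sets"
    have "(\<Union>i<n. A i) \<in> multiplier_sets" for n
      using A by (intro finite_UN) auto
    hence m: "multiplier (indicator (\<Union>i<n. A i))" for n by (simp add: multiplier_sets_def)
    have "multiplier (indicator (\<Union>i. A i))"
      by (rule multiplier_limit[where C = 1, OF m _ LIMSEQ_indicator_UN]) (auto simp: indicator_def)
    thus "(\<Union>i. A i) \<in> multiplier_sets" by (simp add: multiplier_sets_def)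
  qed
qed

lemma null_set_multiplier_sets:
  assumes "N \<in> null_sets lebesgue"
  shows "N \<in> multiplier_sets"
  unfolding multiplier_sets_def mem_Collect_eq multiplier_def
proof
  fix f assume f: "f \<in> V"
  have [measurable]: "N \<in> sets lebesgue" "f \<in> borel_measurable lebesgue"
    using assms f subset_L2 by (auto intro: L2_measurable)
  show "(\<lambda>x. indicator N x * f x) \<in> V"
  proof (rule AE_eq[OF zero])
    show "AE x in lebesgue. 0 = indicator N x * f x"
      using AE_not_in[OF assms] by eventually_elim simp
  qed measurable
qed

text \<open>Measurability of \<open>frac\<close> from the sigma algebra of multiplier sets to the
  Borel sets extends closed arcs to all Borel sets. The remaining null part of a Lebesgue set is
  harmless: its preimage under \<open>frac\<close> lies in countably many integer translates of a
  null set.\<close>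

lemma frac_vimage_multiplier_sets:
  assumes "B \<in> sets lebesgue"
  shows "frac -` B \<in> multiplier_sets"
proof -
  interpret sigma_algebra UNIV multiplier_sets by (rule sigma_algebra_multiplier_sets)
  have "{x. frac x \<le> t} \<in> multiplier_sets" for t
  proof -
    consider "t < 0" | "0 \<le> t" "t < 1" | "t \<ge> 1" by linarith
    thus ?thesis
    proof cases
      case 1
      hence "{x. frac x \<le> t} = {}" by (auto simp: not_le intro: less_le_trans)
      thus ?thesis by simp
    next
      case 2
      have "closed (circ ` {0..t})"
        by (intro compact_imp_closed compact_continuous_image continuous_on_circ compact_Icc)
      moreover have "indicator {x. frac x \<le> t} = (\<lambda>x. indicator (circ ` {0..t}) (circ x) :: complex)"
        by (auto simp: indicator_def frac_le_iff_circ[OF 2])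
      ultimately show ?thesis
        unfolding multiplier_sets_def mem_Collect_eq using multiplier_closed by simp
    next
      case 3
      hence "{x. frac x \<le> t} = UNIV" by (auto intro: order_trans[OF less_imp_le[OF frac_lt_1]])
      thus ?thesis using top by simp
    qed
  qed
  hence frac: "frac \<in> borel_measurable (sigma UNIV multiplier_sets)"
    by (subst borel_measurable_iff_le) (simp add: sigma_sets_eq)
  have borel: "frac -` S \<in> multiplier_sets" if "S \<in> sets borel" for S
    using measurable_sets[OF frac that] by (simp add: sigma_sets_eq)
  obtain S N N' where B: "B = S \<union> N" "S \<in> sets lborel" "N' \<in> null_sets lborel" "N \<subseteq> N'"
    using assms by (auto simp: sets_completion)
  have "frac -` N \<in> null_sets lebesgue"
  proof (rule null_sets_completion_subset)
    show "frac -` N \<subseteq> (\<Union>n :: int. {x. x - of_int n \<in> N'})"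
    proof
      fix x assume "x \<in> frac -` N"
      hence "x - of_int \<lfloor>x\<rfloor> \<in> N'" using B(4) by (auto simp: frac_def)
      thus "x \<in> (\<Union>n :: int. {x. x - of_int n \<in> N'})" by blast
    qed
    show "(\<Union>n :: int. {x. x - of_int n \<in> N'}) \<in> null_sets lebesgue"
      by (intro null_sets_UN null_sets_completionI null_sets_translation B)
  qed
  hence "frac -` S \<union> frac -` N \<in> multiplier_sets"
    using B(2) by (intro Un null_set_multiplier_sets borel) auto
  thus ?thesis by (simp add: B(1))
qed

end

subsection \<open>Integrals over the line as integrals of sums over fibres\<close>

lemma shift_measurable_lebesgue: "(\<lambda>x :: real. x + c) \<in> lebesgue \<rightarrow>\<^sub>M lebesgue"
  using lebesgue_affine_measurable[of "\<lambda>_ :: real. 1" c] by (simp add: add.commute)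

lemma measurable_shift [measurable (raw)]:
  fixes f :: "real \<Rightarrow> 'a :: topological_space"
  assumes "f \<in> borel_measurable lebesgue"
  shows "(\<lambda>x. f (x + c)) \<in> borel_measurable lebesgue"
  using measurable_compose[OF shift_measurable_lebesgue assms] .

lemma nn_integral_shift:
  fixes f :: "real \<Rightarrow> ennreal"
  assumes "f \<in> borel_measurable lebesgue"
  shows "(\<integral>\<^sup>+x. f (x + c) \<partial>lebesgue) = (\<integral>\<^sup>+x. f x \<partial>lebesgue)"
  using nn_integral_real_affine_lebesgue[OF assms, of 1 c] by (simp add: add.commute)

lemma AE_shift:
  fixes P :: "real \<Rightarrow> bool"
  assumes "AE x in lebesgue. P x"
  shows "AE x in lebesgue. P (x + c)"
proof -
  have "AE x in lborel. P x" using assms by (simp add: AE_completion_iff)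
  then obtain N where N: "N \<in> null_sets lborel" "{x. \<not> P x} \<subseteq> N"
    by (auto simp: eventually_ae_filter)
  have "{x. x - (- c) \<in> N} \<in> null_sets lborel"
    by (rule null_sets_translation[OF N(1)])
  hence "AE x in lborel. P (x + c)"
    using N(2) unfolding eventually_ae_filter
    by (intro bexI[of _ "{x. x - (- c) \<in> N}"]) auto
  thus ?thesis by (rule AE_completion)
qed

text \<open>Translate each \<open>[k, k + 1)\<close> to \<open>[0, 1)\<close> and interchange sum
  and integral.\<close>

lemma nn_integral_fibres:
  fixes f :: "real \<Rightarrow> ennreal"
  assumes f [measurable]: "f \<in> borel_measurable lebesgue"
  shows "(\<integral>\<^sup>+x. f x \<partial>lebesgue) =
    (\<integral>\<^sup>+x. (\<integral>\<^sup>+k. f (x + of_int k) \<partial>count_space UNIV) * indicator {0..<1} x \<partial>lebesgue)"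
proof -
  \<comment> \<open>For fixed \<open>x\<close> only the integer part of \<open>x\<close>
    contributes, which collapses the sum over \<open>k\<close> at the end.\<close>
  have ind: "indicator {of_int k..<of_int k + 1} x = (indicator {\<lfloor>x\<rfloor>} k :: ennreal)"
    for k :: int and x :: real
    using floor_eq_iff[of x k] unfolding indicator_def by auto
  have meas_Ico: "(\<lambda>x. f x * indicator {of_int k..<of_int k + 1} x) \<in> borel_measurable lebesgue"
    for k :: int
    by (intro borel_measurable_times_ennreal f borel_measurable_indicator) auto
  have eq: "(\<integral>\<^sup>+x. f (x + of_int k) * indicator {0..<1} x \<partial>lebesgue) =
      (\<integral>\<^sup>+x. f x * indicator {\<lfloor>x\<rfloor>} k \<partial>lebesgue)" for k :: int
  proof -
    have "(\<integral>\<^sup>+x. f x * indicator {\<lfloor>x\<rfloor>} k \<partial>lebesgue) = (\<integral>\<^sup>+x. f x * indicator {of_int k..<of_int k + 1} x \<partial>lebesgue)"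
      unfolding ind ..
    also have "\<dots> = (\<integral>\<^sup>+x. f (x + of_int k) * indicator {of_int k..<of_int k + 1} (x + of_int k) \<partial>lebesgue)"
      by (rule nn_integral_shift[OF meas_Ico, symmetric])
    also have "\<dots> = (\<integral>\<^sup>+x. f (x + of_int k) * indicator {0..<1} x \<partial>lebesgue)"
      by (intro nn_integral_cong) (auto simp: indicator_def)
    finally show ?thesis by simp
  qed
  have meas: "(\<lambda>x. f x * indicator {\<lfloor>x\<rfloor>} k) \<in> borel_measurable lebesgue" for k
    using meas_Ico[of k] unfolding ind .
  have "(\<integral>\<^sup>+x. (\<integral>\<^sup>+k. f (x + of_int k) \<partial>count_space UNIV) * indicator {0..<1} x \<partial>lebesgue) =
      (\<integral>\<^sup>+x. (\<integral>\<^sup>+k. f (x + of_int k) * indicator {0..<1} x \<partial>count_space UNIV) \<partial>lebesgue)"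
    by (simp add: nn_integral_multc)
  also have "\<dots> = (\<integral>\<^sup>+k. (\<integral>\<^sup>+x. f (x + of_int k) * indicator {0..<1} x \<partial>lebesgue) \<partial>count_space UNIV)"
    by (subst nn_integral_count_space_nn_integral)
      (auto intro!: borel_measurable_times_ennreal borel_measurable_indicator measurable_shift)
  also have "\<dots> = (\<integral>\<^sup>+k. (\<integral>\<^sup>+x. f x * indicator {\<lfloor>x\<rfloor>} k \<partial>lebesgue) \<partial>count_space UNIV)"
    by (simp add: eq)
  also have "\<dots> = (\<integral>\<^sup>+x. (\<integral>\<^sup>+k. f x * indicator {\<lfloor>x\<rfloor>} k \<partial>count_space UNIV) \<partial>lebesgue)"
    by (rule nn_integral_count_space_nn_integral[symmetric]) (rule countableI_type, rule meas)
  also have "\<dots> = (\<integral>\<^sup>+x. f x \<partial>lebesgue)"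
    by (intro nn_integral_cong) (simp add: nn_integral_cmult)
  finally show ?thesis ..
qed

lemma measurable_fibre_sum:
  fixes f :: "int \<Rightarrow> 'a \<Rightarrow> ennreal"
  assumes [measurable]: "\<And>k. f k \<in> borel_measurable M"
  shows "(\<lambda>x. \<integral>\<^sup>+k. f k x \<partial>count_space UNIV) \<in> borel_measurable M"
proof -
  interpret sigma_finite_measure "count_space (UNIV :: int set)"
    by (rule sigma_finite_measure_count_space)
  have "case_prod (\<lambda>x k. f k x) \<in> borel_measurable (M \<Otimes>\<^sub>M count_space UNIV)"
    unfolding case_prod_beta by (rule measurable_compose_countable[where f = "\<lambda>k z. f k (fst z)" and g = snd]) auto
  thus ?thesis by (rule borel_measurable_nn_integral)
qed

lemma summable_on_if_nn_integral_finite: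
  fixes f :: "'i \<Rightarrow> real"
  assumes "(\<integral>\<^sup>+k. ennreal (f k) \<partial>count_space UNIV) < \<infinity>" "\<And>k. f k \<ge> 0"
  shows "f summable_on UNIV"
proof -
  have "integrable (count_space UNIV) f"
    using assms by (intro integrableI_nonneg) auto
  hence "Infinite_Set_Sum.abs_summable_on f UNIV"
    by (simp add: abs_summable_on_def)
  hence "Infinite_Sum.abs_summable_on f UNIV"
    by (simp only: abs_summable_equivalent)
  thus ?thesis by (rule abs_summable_summable)
qed

lemma norm_ell2_conv_nn_integral:
  "(\<integral>\<^sup>+k. ennreal ((cmod (ell2_nth f k))\<^sup>2) \<partial>count_space UNIV) = ennreal ((norm f)\<^sup>2)"
proof -
  have "Infinite_Sum.abs_summable_on (\<lambda>k. (cmod (ell2_nth f k))\<^sup>2) UNIV"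
    using ell2_nth_summable[of f] by simp
  hence *: "Infinite_Set_Sum.abs_summable_on (\<lambda>k. (cmod (ell2_nth f k))\<^sup>2) UNIV"
    by (simp only: abs_summable_equivalent)
  show ?thesis
    using nn_integral_conv_infsetsum[OF *] infsetsum_infsum[OF *] by (simp add: norm_ell2_squared)
qed

lemma L2_sq_fibres:
  assumes [measurable]: "f \<in> borel_measurable lebesgue"
  shows "L2_sq f = (\<integral>\<^sup>+x. (\<integral>\<^sup>+k. ennreal ((cmod (f (x + of_int k)))\<^sup>2) \<partial>count_space UNIV)
    * indicator {0..<1} x \<partial>lebesgue)"
  unfolding L2_sq_def by (rule nn_integral_fibres) measurable

lemma L2_sq_indicator:
  assumes "B \<in> sets lebesgue"
  shows "L2_sq (indicator B) = emeasure lebesgue B"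
proof -
  have "(\<lambda>x. ennreal ((cmod (indicator B x))\<^sup>2)) = indicator B"
    by (auto simp: indicator_def fun_eq_iff)
  thus ?thesis using assms by (simp add: L2_sq_def del: emeasure_completion)
qed

lemma L2_sq_translation:
  assumes "f \<in> borel_measurable lebesgue"
  shows "L2_sq (translation c f) = L2_sq f"
  using nn_integral_shift[of "\<lambda>x. ennreal ((cmod (f x))\<^sup>2)" "- c"] assms
  by (simp add: L2_sq_def translation_def)

lemma L2_translation: "f \<in> L2 \<Longrightarrow> translation c f \<in> L2"
  using measurable_shift[of f "- c"] by (simp add: L2_iff L2_sq_translation) (simp add: translation_def)

section \<open>From the delta sequence on fibres to all of \<open>L2\<close>\<close>

locale shift_invariant_subspace = modulation_invariant_subspace +
  assumes translation_mem: "f \<in> V \<Longrightarrow> translation (of_int n) f \<in> V"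
begin

text \<open>The sets \<open>frac -` R j\<close> below partition almost all of \<open>frac -` B\<close> according to the first member
  of a countable family that approximates the delta sequence on the fibre. This makes the choice
  of coefficients measurable and periodic.\<close>

lemma indicator_unit_interval_mem:
  assumes g: "g \<in> V" and ray: "AE x in lebesgue. x < \<alpha> \<longrightarrow> g x = 0"
    and cover: "AE x in lebesgue. \<exists>n :: int. g (x - of_int n) \<noteq> 0"
    and B: "B \<in> sets lebesgue" "B \<subseteq> {0..<1}"
  shows "indicator B \<in> V"
proof (rule closed)
  have g_meas [measurable]: "g \<in> borel_measurable lebesgue"
    using g subset_L2 by (auto intro: L2_measurable)
  have [measurable]: "B \<in> sets lebesgue" by fact
  show "indicator B \<in> L2"
  proof -
    have "L2_sq (indicator B) = emeasure lebesgue B"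
      using B(1) by (rule L2_sq_indicator)
    also have "\<dots> \<le> emeasure lebesgue {0..<1::real}"
      using B by (intro emeasure_mono) auto
    finally show ?thesis by (auto simp: L2_iff intro: le_less_trans)
  qed
  fix e :: real assume e: "e > 0"
  obtain D :: "complex set" where D: "countable D" "closure D = UNIV"
  proof -
    obtain D :: "complex set" where "countable D" "\<And>X. open X \<Longrightarrow> X \<noteq> {} \<Longrightarrow> \<exists>d\<in>D. d \<in> X"
      using countable_dense_setE by blast
    moreover from this have "closure D = UNIV"
      by (auto simp: closure_iff_nhds_not_empty Int_def) (metis disjoint_iff interior_subset open_interior subsetD empty_iff)
    ultimately show ?thesis using that by blast
  qed
  define L where "L = from_nat_into (lists ((UNIV :: int set) \<times> D))"
  have range_L: "range L = {l. set l \<subseteq> UNIV \<times> D}"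
  proof -
    have "lists ((UNIV :: int set) \<times> D) \<noteq> {}" by blast
    moreover have "countable (lists ((UNIV :: int set) \<times> D))" using D by auto
    ultimately show ?thesis unfolding L_def by (subst range_from_nat_into) (auto simp: lists_eq_set)
  qed
  \<comment> \<open>At \<open>x + of_int k\<close>, \<open>A j\<close> is the entry \<open>k\<close>
    of the combination with coefficients \<open>L j\<close> of translates of the fibre of
    \<open>g\<close> over \<open>x\<close>.\<close>
  define A where "A = (\<lambda>j x. \<Sum>(n, c)\<leftarrow>L j. c * g (x - of_int n))"
  have A_V: "A j \<in> V" for j
  proof -
    have "(\<lambda>x. \<Sum>(n, c)\<leftarrow>l. c * g (x - of_int n)) \<in> V" for l :: "(int \<times> complex) list"
    proof (induction l)
      case (Cons nc l)
      obtain n c where nc: "nc = (n, c)" by (cases nc)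
      show ?case using add[OF cmult[OF translation_mem[OF g, of n], of c] Cons]
        by (simp add: nc translation_def)
    qed (simp add: zero)
    thus ?thesis by (simp add: A_def)
  qed
  have [measurable]: "A j \<in> borel_measurable lebesgue" for j
    using A_V subset_L2 by (auto intro: L2_measurable)
  \<comment> \<open>Squared \<open>ell2\<close> distance between the delta sequence and
    \<open>A j\<close> on the fibre over \<open>x\<close>.\<close>
  define \<Delta> where "\<Delta> = (\<lambda>j x. \<integral>\<^sup>+k. ennreal ((cmod (of_bool (k = 0) - A j (x + of_int k)))\<^sup>2) \<partial>count_space UNIV)"
  have [measurable]: "\<Delta> j \<in> borel_measurable lebesgue" for j
    unfolding \<Delta>_def by (rule measurable_fibre_sum) measurable
  \<comment> \<open>Half of \<open>e\<close>, since integration leaves only a weak inequality and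
    the final bound has to be strict.\<close>
  define Q where "Q = (\<lambda>j. {x \<in> space lebesgue. \<Delta> j x < ennreal (e / 2)})"
  have [measurable]: "Q j \<in> sets lebesgue" for j
    unfolding Q_def by measurable
  define R where "R = (\<lambda>j. B \<inter> (Q j - (\<Union>i<j. Q i)))"
  have [measurable]: "R j \<in> sets lebesgue" for j
    unfolding R_def by measurable
  have R_B: "R j \<subseteq> {0..<1}" for j using B by (auto simp: R_def)
  have R_unique: "i = j" if "x \<in> R i" "x \<in> R j" for x i j
    using that by (cases i j rule: linorder_cases) (auto simp: R_def)
  define h where "h = (\<lambda>J x. \<Sum>j<J. indicator (frac -` R j) x * A j x)"
  have h_V: "h J \<in> V" for J
    unfolding h_def
  proof (rule sum)
    fix j
    have "multiplier (indicator (frac -` R j))"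
      using frac_vimage_multiplier_sets[of "R j"] by (simp add: multiplier_sets_def)
    thus "(\<lambda>x. indicator (frac -` R j) x * A j x) \<in> V"
      by (rule multiplierD[OF _ A_V])
  qed
  have h_in: "h J x = (if i < J then A i x else 0)" if "frac x \<in> R i" for J x i
  proof -
    have "indicator (frac -` R j) x * A j x = (if j = i then A i x else 0)" for j
      using that R_unique by (auto simp: indicator_def)
    thus ?thesis unfolding h_def by (simp only:) simp
  qed
  have h_out: "h J x = 0" if "\<And>i. frac x \<notin> R i" for J x
    using that by (simp add: h_def)
  \<comment> \<open>\<open>H\<close> glues infinitely many pieces, so its membership in
    \<open>V\<close> is open until it is known to lie in \<open>L2\<close>; the partial gluings
    \<open>h J\<close> are finite sums and lie in \<open>V\<close>.\<close>
  define H where "H = (\<lambda>x. if \<exists>i. frac x \<in> R i then A (THE i. frac x \<in> R i) x else 0)"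
  have H_in: "H x = A i x" if "frac x \<in> R i" for x i
  proof -
    have "(THE i. frac x \<in> R i) = i" using that R_unique by blast
    thus ?thesis using that by (auto simp: H_def)
  qed
  have H_out: "H x = 0" if "\<And>i. frac x \<notin> R i" for x
    using that by (simp add: H_def)
  have lim: "(\<lambda>J. h J x) \<longlonglongrightarrow> H x" for x
  proof (cases "\<exists>i. frac x \<in> R i")
    case True
    then obtain i where i: "frac x \<in> R i" ..
    show ?thesis
      by (rule tendsto_eventually, rule eventually_sequentiallyI[of "Suc i"])
        (simp add: h_in[OF i] H_in[OF i])
  qed (simp add: h_out H_out)
  have h_le: "cmod (h J x) \<le> cmod (H x)" for J x
    by (cases "\<exists>i. frac x \<in> R i") (auto simp: h_in H_in h_out)
  have H_meas [measurable]: "H \<in> borel_measurable lebesgue"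
    by (rule borel_measurable_LIMSEQ_metric[OF _ lim]) (use h_V subset_L2 in \<open>auto intro: L2_measurable\<close>)
  have fibre: "\<exists>j. x \<in> Q j" if x: "(\<integral>\<^sup>+k. ennreal ((cmod (g (x + of_int k)))\<^sup>2) \<partial>count_space (UNIV :: int set)) < \<infinity>"
    "\<And>k :: int. x + of_int k < \<alpha> \<Longrightarrow> g (x + of_int k) = 0" "g (x + of_int n) \<noteq> 0" for x and n :: int
  proof -
    have "(\<lambda>k :: int. (cmod (g (x + of_int k)))\<^sup>2) summable_on UNIV"
      using x(1) by (rule summable_on_if_nn_integral_finite) auto
    hence "ell2_nth (Abs_ell2 (\<lambda>k. g (x + of_int k))) = (\<lambda>k. g (x + of_int k))"
      by (intro Abs_ell2_inverse) simp
    then obtain G where G: "ell2_nth G = (\<lambda>k. g (x + of_int k))" ..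
    have "ell2_unit \<in> closure {\<Sum>(n, c)\<leftarrow>l. ell2_shift n c G | l. set l \<subseteq> UNIV \<times> D}"
    proof (rule ell2_unit_in_closure_shifts[OF D(2)])
      show "G \<noteq> 0" using x(3) G by (auto simp: ell2_nth_simps dest!: fun_cong[of _ _ n])
      \<comment> \<open>For these \<open>k\<close> the point \<open>x + of_int k\<close> lies to the
        left of \<alpha>.\<close>
      show "ell2_nth G k = 0" if "k < \<lfloor>\<alpha> - x\<rfloor>" for k
        unfolding G using that by (intro x(2)) linarith
    qed
    moreover have "sqrt (e / 2) > 0" using e by simp
    ultimately obtain y where "y \<in> {\<Sum>(n, c)\<leftarrow>l. ell2_shift n c G | l. set l \<subseteq> UNIV \<times> D}"
      "dist y ell2_unit < sqrt (e / 2)"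
      unfolding closure_approachable by blast
    then obtain l where l: "set l \<subseteq> UNIV \<times> D"
      "dist (\<Sum>(n, c)\<leftarrow>l. ell2_shift n c G) ell2_unit < sqrt (e / 2)"
      by blast
    from l(1) obtain j where j: "l = L j" using range_L by blast
    define E where "E = ell2_unit - (\<Sum>(n, c)\<leftarrow>l. ell2_shift n c G)"
    have "ell2_nth (\<Sum>(n, c)\<leftarrow>l. ell2_shift n c G) k = (\<Sum>(n, c)\<leftarrow>l. c * g (x + of_int k - of_int n))" for k
      by (induction l) (auto simp: ell2_nth_simps ell2_shift.rep_eq G algebra_simps)
    hence "ell2_nth E k = of_bool (k = 0) - A j (x + of_int k)" for k
      by (simp add: E_def ell2_nth_simps ell2_unit.rep_eq A_def j)
    hence "\<Delta> j x = ennreal ((norm E)\<^sup>2)"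
      using norm_ell2_conv_nn_integral[of E] by (simp add: \<Delta>_def)
    also have "norm E < sqrt (e / 2)"
      using l(2) by (simp add: E_def dist_norm norm_minus_commute)
    hence "(norm E)\<^sup>2 < (sqrt (e / 2))\<^sup>2"
      by (intro power_strict_mono) auto
    hence "ennreal ((norm E)\<^sup>2) < ennreal (e / 2)"
      using e by (simp add: ennreal_less_iff)
    finally show ?thesis by (auto simp: Q_def)
  qed
  have AE_Q: "AE x in lebesgue. x \<in> {0..<1} \<longrightarrow> (\<exists>j. x \<in> Q j)"
  proof -
    have "L2_sq g < \<infinity>" using g subset_L2 by (auto simp: L2_iff)
    hence fin: "AE x in lebesgue. (\<integral>\<^sup>+k. ennreal ((cmod (g (x + of_int k)))\<^sup>2) \<partial>count_space (UNIV :: int set))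
        * indicator {0..<1} x \<noteq> \<infinity>"
      unfolding L2_sq_fibres[OF g_meas]
      by (intro nn_integral_PInf_AE borel_measurable_times_ennreal measurable_fibre_sum
          borel_measurable_indicator) auto
    have ray': "AE x in lebesgue. \<forall>k :: int. x + of_int k < \<alpha> \<longrightarrow> g (x + of_int k) = 0"
      using AE_shift[OF ray] by (simp add: AE_all_countable)
    from fin ray' cover show ?thesis
    proof eventually_elim
      case (elim x)
      show ?case
      proof
        assume x: "x \<in> {0..<1}"
        obtain n :: int where "g (x - of_int n) \<noteq> 0" using elim(3) by blast
        hence "g (x + of_int (- n)) \<noteq> 0" by simp
        thus "\<exists>j. x \<in> Q j"
          using elim(1,2) x by (intro fibre[where n = "- n"]) (auto simp: less_top)
      qed
    qed
  qed
  have approx: "L2_sq (\<lambda>x. indicator B x - H x) \<le> ennreal (e / 2)"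
  proof -
    have "L2_sq (\<lambda>x. indicator B x - H x) = (\<integral>\<^sup>+x. (\<integral>\<^sup>+k. ennreal ((cmod (indicator B (x + of_int k) - H (x + of_int k)))\<^sup>2)
        \<partial>count_space UNIV) * indicator {0..<1} x \<partial>lebesgue)"
      by (rule L2_sq_fibres) measurable
    also have "\<dots> \<le> (\<integral>\<^sup>+x. ennreal (e / 2) * indicator {0..<1::real} x \<partial>lebesgue)"
    proof (rule nn_integral_mono_AE)
      show "AE x in lebesgue. (\<integral>\<^sup>+k. ennreal ((cmod (indicator B (x + of_int k) - H (x + of_int k)))\<^sup>2)
        \<partial>count_space UNIV) * indicator {0..<1} x \<le> ennreal (e / 2) * indicator {0..<1} x"
        using AE_Q
      proof eventually_elim
        case (elim x)
        show ?case
        proof (cases "x \<in> {0..<1}")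
          case True
          have frac: "frac (x + of_int k) = x" for k
            using True by (simp add: frac_unique_iff)
          \<comment> \<open>As \<open>B\<close> lies in \<open>[0, 1)\<close>, the fibre of its
            indicator over \<open>x\<close> is the delta sequence for \<open>x\<close> in
            \<open>B\<close> and zero otherwise.\<close>
          have B_iff: "x + of_int k \<in> B \<longleftrightarrow> k = 0 \<and> x \<in> B" for k :: int
          proof
            assume *: "x + of_int k \<in> B"
            hence "0 \<le> x + of_int k" "x + of_int k < 1" using B by auto
            hence "k = 0" using True by simp
            with * show "k = 0 \<and> x \<in> B" by simp
          qed auto
          have "(\<integral>\<^sup>+k. ennreal ((cmod (indicator B (x + of_int k) - H (x + of_int k)))\<^sup>2) \<partial>count_space UNIV)
              \<le> ennreal (e / 2)"
          proof (cases "x \<in> B")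
            case xB: True
            define j where "j = (LEAST j. x \<in> Q j)"
            have "\<exists>j. x \<in> Q j" using elim True by blast
            hence "x \<in> Q j" unfolding j_def by (rule LeastI_ex)
            moreover have "x \<notin> Q i" if "i < j" for i
              using not_less_Least that unfolding j_def by blast
            ultimately have "x \<in> R j" using xB by (auto simp: R_def)
            hence "H (x + of_int k) = A j (x + of_int k)" for k
              by (intro H_in) (simp only: frac)
            moreover have "indicator B (x + of_int k) = (of_bool (k = 0) :: complex)" for k
              using xB by (simp add: indicator_def B_iff)
            ultimately show ?thesis
              using \<open>x \<in> Q j\<close> by (simp add: Q_def \<Delta>_def less_imp_le)
          next
            case False
            have "H (x + of_int k) = 0" for k
              by (rule H_out) (use False in \<open>simp only: frac R_def, simp\<close>)
            moreover have "indicator B (x + of_int k) = (0 :: complex)" for k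
              using False by (simp add: indicator_def B_iff)
            ultimately show ?thesis by simp
          qed
          thus ?thesis using True by simp
        qed simp
      qed
    qed
    also have "\<dots> = ennreal (e / 2)"
      by (subst nn_integral_cmult_indicator) auto
    finally show ?thesis .
  qed
  \<comment> \<open>Square integrability of \<open>H\<close> comes from the approximation itself; by
    \<open>h_le\<close>, \<open>H\<close> is then its own majorant in the limit of the
    \<open>h J\<close>.\<close>
  have "(\<lambda>x. indicator B x - H x) \<in> L2"
    using le_less_trans[OF approx, of \<infinity>] by (simp add: L2_iff)
  hence "(\<lambda>x. indicator B x - (indicator B x - H x)) \<in> L2"
    by (rule L2_diff[OF \<open>indicator B \<in> L2\<close>])
  hence "H \<in> L2" by simp
  hence "H \<in> V"
    by (rule dominated_limit[where h = h and w = H, OF h_V H_meas]) (use h_le lim in auto)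
  moreover have "ennreal (e / 2) < ennreal e" using e by (simp add: ennreal_less_iff)
  ultimately show "\<exists>f\<in>V. L2_sq (\<lambda>x. indicator B x - f x) < ennreal e"
    using le_less_trans[OF approx, of "ennreal e"] by blast
qed

text \<open>Each slice of \<open>B\<close> between consecutive integers is a translate of a subset
  of \<open>[0, 1)\<close>; finite unions of slices converge, dominated by the indicator of
  \<open>B\<close>.\<close>

lemma indicator_mem:
  assumes unit: "\<And>B. B \<in> sets lebesgue \<Longrightarrow> B \<subseteq> {0..<1} \<Longrightarrow> indicator B \<in> V"
    and B: "B \<in> sets lebesgue" "indicator B \<in> L2"
  shows "indicator B \<in> V"
proof -
  have slice: "indicator (B \<inter> {x. \<lfloor>x\<rfloor> = k}) \<in> V" for k
  proof -
    have eq: "{x. \<lfloor>x\<rfloor> = k} = {of_int k..<of_int k + 1}" by (auto simp: floor_eq_iff)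
    have "(\<lambda>x. x + of_int k) -` (B \<inter> {of_int k..<of_int k + 1}) \<inter> space lebesgue \<in> sets lebesgue"
      by (intro measurable_sets[OF shift_measurable_lebesgue]) (use B in auto)
    hence "indicator ((\<lambda>x. x + of_int k) -` (B \<inter> {of_int k..<of_int k + 1})) \<in> V"
      by (intro unit) auto
    from translation_mem[OF this, of k] show ?thesis
      by (simp add: translation_def eq indicator_def[abs_def] diff_less_eq add.commute)
  qed
  define h where "h = (\<lambda>K :: nat. indicator (B \<inter> {x. \<lfloor>x\<rfloor> \<in> {- int K..<int K}}) :: real \<Rightarrow> complex)"
  show ?thesis
  proof (rule dominated_limit[where h = h and w = "indicator B"])
    show "h K \<in> V" for K
    proof -
      have "h K = (\<lambda>x. \<Sum>k\<in>{- int K..<int K}. indicator (B \<inter> {x. \<lfloor>x\<rfloor> = k}) x)"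
        by (auto simp: h_def indicator_def fun_eq_iff)
      thus ?thesis using sum[OF slice] by simp
    qed
    show "AE x in lebesgue. (\<lambda>K. h K x) \<longlonglongrightarrow> indicator B x"
    proof (rule always_eventually, rule allI, rule tendsto_eventually)
      fix x
      show "\<forall>\<^sub>F K in sequentially. h K x = indicator B x"
        by (rule eventually_sequentiallyI[of "nat (\<bar>\<lfloor>x\<rfloor>\<bar> + 1)"]) (auto simp: h_def indicator_def)
    qed
  qed (use B in \<open>auto simp: h_def indicator_def\<close>)
qed

lemma eq_L2_if_indicators:
  assumes ind: "\<And>B. B \<in> sets lebesgue \<Longrightarrow> indicator B \<in> L2 \<Longrightarrow> indicator B \<in> V"
  shows "V = L2"
proof
  show "L2 \<subseteq> V"
  proof
    fix f assume f: "f \<in> L2"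
    have f_meas: "f \<in> borel_measurable lebesgue" using f by (rule L2_measurable)
    obtain s where s: "\<And>i. simple_function lebesgue (s i)" "\<And>x. (\<lambda>i. s i x) \<longlonglongrightarrow> f x"
      "\<And>i x. cmod (s i x) \<le> 2 * cmod (f x)"
      using borel_measurable_implies_sequence_metric[OF f_meas, of 0] by (auto simp: dist_norm)
    have s_V: "s i \<in> V" for i
    proof -
      have fin: "finite (range (s i))" using s(1)[of i] by (auto simp: simple_function_def)
      have sets: "s i -` {y} \<in> sets lebesgue" if "y \<in> range (s i)" for y
        using s(1)[of i] that by (auto simp: simple_function_def)
      have "(\<lambda>x. y * indicator (s i -` {y}) x) \<in> V" if y: "y \<in> range (s i)" for y
      proof (cases "y = 0")
        case False
        have "indicator (s i -` {y}) \<in> L2"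
        \<comment> \<open>Where \<open>s i\<close> takes the value \<open>y\<close>,
          \<open>s(3)\<close> bounds the modulus of \<open>y\<close> by twice that of
          \<open>f\<close>, so this multiple of \<open>f\<close> dominates the indicator.\<close>
        proof (rule L2_bounded[where g = "\<lambda>x. (2 / y) * f x"])
          show "cmod (indicator (s i -` {y}) x) \<le> cmod (2 / y * f x)" for x
            using s(3)[of i x] False by (auto simp: indicator_def norm_mult norm_divide field_simps)
        qed (use sets[OF y] L2_cmult[OF f, of "2 / y"] in auto)
        thus ?thesis by (intro cmult ind sets y)
      qed (simp add: zero)
      hence "(\<lambda>x. \<Sum>y\<in>range (s i). y * indicator (s i -` {y}) x) \<in> V" by (rule sum)
      also have "(\<lambda>x. \<Sum>y\<in>range (s i). y * indicator (s i -` {y}) x) = s i"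
      proof
        fix x
        have "(\<Sum>y\<in>range (s i). y * indicator (s i -` {y}) x) = (\<Sum>y\<in>range (s i). if y = s i x then y else 0)"
          by (intro sum.cong) (auto simp: indicator_def)
        thus "(\<Sum>y\<in>range (s i). y * indicator (s i -` {y}) x) = s i x"
          using fin by simp
      qed
      finally show ?thesis .
    qed
    show "f \<in> V"
    proof (rule dominated_limit[where h = s and w = "\<lambda>x. 2 * f x"])
      show "AE x in lebesgue. cmod (s i x) \<le> cmod (2 * f x)" for i
        using s(3) by (simp add: norm_mult)
    qed (use s(2) s_V f_meas L2_cmult[OF f] in auto)
  qed
qed (rule subset_L2)

end

subsection \<open>Gabor systems\<close>

text \<open>A linear isometry preserving \<open>S\<close> maps approximants in the span to
  approximants in the span, with the same error. It serves for both modulations and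
  translations.\<close>

lemma L2_closure_span_invariant:
  assumes S: "S \<subseteq> L2" and f: "f \<in> L2_closure (linear_span S)"
    and TS: "\<And>s. s \<in> S \<Longrightarrow> T s \<in> S"
    and T_add: "\<And>f h. T (\<lambda>x. f x + h x) = (\<lambda>x. T f x + T h x)"
    and T_cmult: "\<And>c f. T (\<lambda>x. c * f x) = (\<lambda>x. c * T f x)"
    and T_L2: "\<And>f. f \<in> L2 \<Longrightarrow> T f \<in> L2"
    and T_isom: "\<And>f. f \<in> L2 \<Longrightarrow> L2_sq (T f) = L2_sq f"
  shows "T f \<in> L2_closure (linear_span S)"
proof -
  have span: "linear_span S \<subseteq> L2" by (rule linear_span_subset_L2[OF S])
  have T_span: "T h \<in> linear_span S" if "h \<in> linear_span S" for h
    using that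
  proof (induction rule: linear_span_induct)
    case zero
    show ?case using T_cmult[of 0 "\<lambda>x. 0"] linear_span_zero by simp
  qed (auto simp: T_add T_cmult intro: linear_span_add linear_span_cmult linear_span_base TS)
  have T_diff: "T (\<lambda>x. f x - h x) = (\<lambda>x. T f x - T h x)" for f h
    using T_add[of f "\<lambda>x. -1 * h x"] T_cmult[of "-1" h] by simp
  show ?thesis
    unfolding L2_closure_iff[OF span]
  proof safe
    show "T f \<in> L2" using f by (auto simp: L2_closure_def intro: T_L2)
    fix e :: real assume "e > 0"
    then obtain h where h: "h \<in> linear_span S" "L2_sq (\<lambda>x. f x - h x) < ennreal e"
      using f unfolding L2_closure_iff[OF span] by meson
    have "(\<lambda>x. f x - h x) \<in> L2"
      using f h span by (intro L2_diff) (auto simp: L2_closure_def)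
    from T_isom[OF this] have "L2_sq (\<lambda>x. T f x - T h x) < ennreal e"
      using h by (simp add: T_diff)
    with T_span[OF h(1)] show "\<exists>g\<in>linear_span S. L2_sq (\<lambda>x. T f x - g x) < ennreal e"
      by (intro bexI[of _ "T h"])
  qed
qed

lemma L2_sq_modulation: "L2_sq (modulation c f) = L2_sq f"
  by (simp add: L2_sq_def modulation_def norm_mult norm_exp_eq_Re)

lemma L2_modulation:
  assumes "f \<in> L2"
  shows "modulation c f \<in> L2"
proof -
  have "(\<lambda>x. exp (2 * of_real pi * \<i> * of_real c * of_real x) :: complex) \<in> borel_measurable borel"
    by (intro borel_measurable_continuous_onI continuous_intros)
  hence "(\<lambda>x. exp (2 * of_real pi * \<i> * of_real c * of_real x) :: complex) \<in> borel_measurable lebesgue"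
    by (simp add: measurable_completion)
  hence "modulation c f \<in> borel_measurable lebesgue"
    unfolding modulation_def using L2_measurable[OF assms] by (rule borel_measurable_times)
  thus ?thesis using assms by (simp add: L2_iff L2_sq_modulation)
qed

lemma modulation_modulation: "modulation c (modulation d f) = modulation (c + d) f"
  by (simp add: modulation_def fun_eq_iff algebra_simps flip: exp_add)

text \<open>The two operators commute up to the factor \<open>exp (- 2 pi i m k)\<close>, which is 1
  for integers; without a phase left over, translations permute the system.\<close>

lemma translation_modulation_int:
  "translation (of_int k) (modulation (of_int m) (translation (of_int n) g)) =
    modulation (of_int m) (translation (of_int (k + n)) g)"
proof -
  have "exp (2 * of_real pi * \<i> * of_real (of_int m) * of_real (x - of_int k)) =
      exp (2 * of_real pi * \<i> * of_real (of_int m) * of_real x :: complex)" for x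
    unfolding exp_eq by (intro exI[of _ "- (m * k)"]) (simp add: algebra_simps)
  thus ?thesis
    by (simp add: translation_def modulation_def fun_eq_iff algebra_simps del: of_real_diff)
qed

text \<open>In \<open>ennreal\<close> the supremum exists for unbounded families too, and 0 is the
  bottom element.\<close>

lemma SUP_cmod_eq_0_iff:
  "(SUP n \<in> I. ennreal (cmod (f n))) = 0 \<longleftrightarrow> (\<forall>n\<in>I. f n = 0)"
  unfolding bot_ennreal[symmetric] SUP_bot_conv by (simp add: bot_ennreal)

lemma complete_imp_AE_ex_nonzero_translate:
  fixes g :: "real \<Rightarrow> complex"
  assumes g: "g \<in> L2"
    and complete: "complete_in_L2 (\<lambda>(m :: int, n :: int). modulation (of_int m) (translation (of_int n) g))"
  shows "AE x in lebesgue. \<exists>n :: int. g (x - of_int n) \<noteq> 0"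
proof -
  define S where "S = range (\<lambda>(m :: int, n :: int). modulation (of_int m) (translation (of_int n) g))"
  have S: "S \<subseteq> L2" "L2_closure (linear_span S) = L2"
    using complete by (auto simp: complete_in_L2_def S_def)
  have [measurable]: "g \<in> borel_measurable lebesgue" using g by (rule L2_measurable)
  have [measurable]: "(\<lambda>x. g (x - of_int n)) \<in> borel_measurable lebesgue" for n :: int
    using measurable_shift[of g "- of_int n"] by simp
  define Z where "Z = {x \<in> space lebesgue. \<forall>n :: int. g (x - of_int n) = 0}"
  have Z: "Z \<in> sets lebesgue"
    unfolding Z_def by measurable
  \<comment> \<open>\<open>Z\<close> is invariant under integer translations and may have infinite
    measure, whereas its slices have indicators in \<open>L2\<close>.\<close>
  have null: "Z \<inter> {of_int k..<of_int k + 1} \<in> null_sets lebesgue" for k :: int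
  proof -
    define B where "B = Z \<inter> {of_int k..<of_int k + 1}"
    have B: "B \<in> sets lebesgue" using Z by (auto simp: B_def)
    have "emeasure lebesgue B \<le> emeasure lebesgue {of_int k..<of_int k + 1 :: real}"
      by (intro emeasure_mono) (auto simp: B_def)
    hence fin: "emeasure lebesgue B < \<infinity>" by (auto intro: le_less_trans)
    have "indicator B \<in> L2"
      using B fin by (simp add: L2_iff L2_sq_indicator)
    hence mem: "indicator B \<in> L2_closure (linear_span S)" using S by simp
    have less: "emeasure lebesgue B < ennreal e" if "e > 0" for e
    proof -
      obtain h where h: "h \<in> linear_span S" "L2_sq (\<lambda>x. indicator B x - h x) < ennreal e"
        using mem \<open>e > 0\<close> unfolding L2_closure_iff[OF linear_span_subset_L2[OF S(1)]] by meson
      have "\<forall>x\<in>Z. h x = 0"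
        using h(1) by (induction rule: linear_span_induct)
          (auto simp: S_def Z_def modulation_def translation_def)
      \<comment> \<open>On \<open>B\<close> the approximant \<open>h\<close> vanishes, and off
        \<open>B\<close> the left side is 0: no \<open>h\<close> in the span is closer to the
        indicator than 0 is.\<close>
      hence "cmod (indicator B x) \<le> cmod (indicator B x - h x)" for x
        by (auto simp: indicator_def B_def)
      hence "L2_sq (indicator B) \<le> L2_sq (\<lambda>x. indicator B x - h x)"
        by (rule L2_sq_mono)
      thus ?thesis using h(2) B by (simp add: L2_sq_indicator del: emeasure_completion)
    qed
    have "emeasure lebesgue B = 0"
    proof (rule ccontr)
      assume "emeasure lebesgue B \<noteq> 0"
      hence "enn2real (emeasure lebesgue B) > 0"
        using fin by (simp add: enn2real_positive_iff zero_less_iff_neq_zero del: emeasure_completion)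
      \<comment> \<open>With the measure of \<open>B\<close> itself as \<open>e\<close>, that
        measure would be smaller than itself.\<close>
      from less[OF this] show False using fin by (simp del: emeasure_completion)
    qed
    thus ?thesis using B unfolding B_def by (intro null_setsI)
  qed
  have "(\<Union>k :: int. Z \<inter> {of_int k..<of_int k + 1}) \<in> null_sets lebesgue"
    by (intro null_sets_UN null)
  also have "(\<Union>k :: int. Z \<inter> {of_int k..<of_int k + 1}) = Z"
  proof -
    have "x \<in> {of_int \<lfloor>x\<rfloor>..<of_int \<lfloor>x\<rfloor> + 1}" for x :: real
      by simp
    thus ?thesis by blast
  qed
  finally show ?thesis
    by (rule AE_I') (auto simp: Z_def)
qed

lemma AE_ex_nonzero_translate_imp_complete:
  fixes g :: "real \<Rightarrow> complex"
  assumes g: "g \<in> L2"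
    and ray: "AE x in lebesgue. x < \<alpha> \<longrightarrow> g x = 0"
    and cover: "AE x in lebesgue. \<exists>n :: int. g (x - of_int n) \<noteq> 0"
  shows "complete_in_L2 (\<lambda>(m :: int, n :: int). modulation (of_int m) (translation (of_int n) g))"
proof -
  define \<phi> where "\<phi> = (\<lambda>(m :: int, n :: int). modulation (of_int m) (translation (of_int n) g))"
  have S: "range \<phi> \<subseteq> L2"
    using g by (auto simp: \<phi>_def intro: L2_modulation L2_translation)
  define V where "V = L2_closure (linear_span (range \<phi>))"
  have mod: "modulation (of_int k) f \<in> V" if "f \<in> V" for f and k :: int
    unfolding V_def
  proof (rule L2_closure_span_invariant[OF S, where T = "modulation (of_int k)"])
    show "modulation (of_int k) s \<in> range \<phi>" if s: "s \<in> range \<phi>" for s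
    proof -
      obtain m n where "s = \<phi> (m, n)" using s by auto
      hence "modulation (of_int k) s = \<phi> (k + m, n)"
        by (simp add: \<phi>_def modulation_modulation)
      thus ?thesis by simp
    qed
  next
    show "modulation (of_int k) (\<lambda>x. f x + h x) = (\<lambda>x. modulation (of_int k) f x + modulation (of_int k) h x)" for f h
      by (simp add: modulation_def distrib_left)
    show "modulation (of_int k) (\<lambda>x. c * f x) = (\<lambda>x. c * modulation (of_int k) f x)" for c f
      by (simp add: modulation_def mult.left_commute)
  qed (use that in \<open>auto simp: V_def L2_modulation L2_sq_modulation\<close>)
  have trans: "translation (of_int k) f \<in> V" if "f \<in> V" for f and k :: int
    unfolding V_def
  proof (rule L2_closure_span_invariant[OF S, where T = "translation (of_int k)"])
    show "translation (of_int k) s \<in> range \<phi>" if s: "s \<in> range \<phi>" for s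
    proof -
      obtain m n where "s = \<phi> (m, n)" using s by auto
      hence "translation (of_int k) s = \<phi> (m, k + n)"
        by (simp add: \<phi>_def translation_modulation_int)
      thus ?thesis by simp
    qed
  next
    show "L2_sq (translation (of_int k) f) = L2_sq f" if "f \<in> L2" for f
      using that by (intro L2_sq_translation L2_measurable)
    show "translation (of_int k) (\<lambda>x. f x + h x) = (\<lambda>x. translation (of_int k) f x + translation (of_int k) h x)" for f h
      by (simp add: translation_def)
    show "translation (of_int k) (\<lambda>x. c * f x) = (\<lambda>x. c * translation (of_int k) f x)" for c f
      by (simp add: translation_def)
  qed (use that in \<open>auto simp: V_def L2_translation\<close>)
  interpret closed_L2_subspace V
    unfolding V_def by (rule closed_L2_subspace_closure[OF S])
  interpret shift_invariant_subspace V
    using mod[of _ 1] mod[of _ "- 1"] trans by unfold_locales auto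
  have "g \<in> V"
  proof -
    have "\<phi> (0, 0) = g" by (simp add: \<phi>_def modulation_def translation_def)
    hence "g \<in> linear_span (range \<phi>)"
      by (intro linear_span_base) (auto intro: range_eqI[of _ _ "(0, 0)"])
    thus ?thesis
      unfolding V_def L2_closure_iff[OF linear_span_subset_L2[OF S]] using g
      by (auto intro!: bexI[of _ g] simp: L2_sq_def)
  qed
  have "V = L2"
    by (rule eq_L2_if_indicators, rule indicator_mem,
        rule indicator_unit_interval_mem[OF \<open>g \<in> V\<close> ray cover])
  thus ?thesis
    using S unfolding complete_in_L2_def \<phi>_def[symmetric] V_def by simp
qed

theorem theorem7p8:
  fixes g :: "real \<Rightarrow> complex" and \<alpha> :: real
  assumes "g \<in> L2"
    and "AE x in lebesgue. x < \<alpha> \<longrightarrow> g x = 0"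
  shows "complete_in_L2 (\<lambda>(m :: int, n :: int). modulation (of_int m) (translation (of_int n) g))
    \<longleftrightarrow> (AE x in lebesgue. (SUP n :: int. ennreal (cmod (g (x - of_int n)))) \<noteq> 0)"
  using complete_imp_AE_ex_nonzero_translate[OF assms(1)]
    AE_ex_nonzero_translate_imp_complete[OF assms]
  by (auto simp: SUP_cmod_eq_0_iff)

end
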